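(* Let $(M,g)$ be a complete $(n+1)$-dimensional Lorentz manifold with constant sectional curvature $c$, and let $\mathcal{F}$ be a spacelike foliation by hypersurfaces of $M$ with a unit timelike vector field $N$ normal to the leaves of $\mathcal{F}$. If $N$ is a geodesic flow (that is, $\nabla_NN=0$), then (1) $c\ge 0$; (2) $H^2\le c$ on $M$, where $H$ is the mean curvature function of the leaves in the direction $N$.
   Context: A Lorentz manifold is a smooth manifold with a pseudo-Riemannian metric of signature $(+,\dots,+,-)$; complete means geodesically complete. Constant sectional curvature $c$ is understood in the usual sense, in which de Sitter space has $c>0$ and anti-de Sitter space has $c<0$. A spacelike foliation by hypersurfaces is a codimension-one foliation such that the induced metric on each leaf is Riemannian. $\nabla$ is the Levi-Civita connection. For a local orthonormal frame $e_1,\dots,e_n$ tangent to the leaves, $h_{ij}=-g(\nabla_{e_j}N,e_i)$ and $H=-\frac1n\sum_{i=1}^n h_{ii}$. *)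

theory Defs
  imports "HOL-Analysis.Analysis" "HOL-Library.Disjoint_Sets"
begin

section \<open>Smooth maps between normed spaces\<close>

text \<open>Only used on open sets of finite-dimensional spaces, where continuity of all directional
  derivatives up to order \<open>k\<close> is the usual notion of a \<open>C\<^sup>k\<close> map.\<close>

primrec Ck_on :: "nat \<Rightarrow> 'a::real_normed_vector set \<Rightarrow> ('a \<Rightarrow> 'b::real_normed_vector) \<Rightarrow> bool" where
  "Ck_on 0 S f \<longleftrightarrow> continuous_on S f"
| "Ck_on (Suc k) S f \<longleftrightarrow>
     (\<forall>x\<in>S. f differentiable (at x)) \<and> (\<forall>v. Ck_on k S (\<lambda>x. frechet_derivative f (at x) v))"

definition smooth_on :: "'a::real_normed_vector set \<Rightarrow> ('a \<Rightarrow> 'b::real_normed_vector) \<Rightarrow> bool" where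
  "smooth_on S f \<longleftrightarrow> (\<forall>k. Ck_on k S f)"


section \<open>Smooth manifolds\<close>

text \<open>The manifold is a whole type \<open>'m\<close> (Hausdorff and second countable by type class), modelled on
  the Euclidean space \<open>'e\<close>. A chart is a pair of its domain and its coordinate map; the values of
  the coordinate map outside the domain are irrelevant.\<close>

type_synonym ('m, 'e) chart = "'m set \<times> ('m \<Rightarrow> 'e)"

abbreviation dom_of :: "('m, 'e) chart \<Rightarrow> 'm set" where "dom_of \<equiv> fst"
abbreviation coord :: "('m, 'e) chart \<Rightarrow> 'm \<Rightarrow> 'e" where "coord \<equiv> snd"

definition img_of :: "('m, 'e) chart \<Rightarrow> 'e set" where
  "img_of \<phi> = coord \<phi> ` dom_of \<phi>"

definition inv_coord :: "('m, 'e) chart \<Rightarrow> 'e \<Rightarrow> 'm" where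
  "inv_coord \<phi> = inv_into (dom_of \<phi>) (coord \<phi>)"

definition transition :: "('m, 'e) chart \<Rightarrow> ('m, 'e) chart \<Rightarrow> 'e \<Rightarrow> 'e" where
  "transition \<phi> \<psi> = coord \<psi> \<circ> inv_coord \<phi>"

definition is_chart :: "('m::topological_space, 'e::euclidean_space) chart \<Rightarrow> bool" where
  "is_chart \<phi> \<longleftrightarrow> open (dom_of \<phi>) \<and> open (img_of \<phi>) \<and>
     homeomorphism (dom_of \<phi>) (img_of \<phi>) (coord \<phi>) (inv_coord \<phi>)"

definition compatible ::
  "('m::topological_space, 'e::euclidean_space) chart \<Rightarrow> ('m, 'e) chart \<Rightarrow> bool" where
  "compatible \<phi> \<psi> \<longleftrightarrow>
     smooth_on (coord \<phi> ` (dom_of \<phi> \<inter> dom_of \<psi>)) (transition \<phi> \<psi>) \<and>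
     smooth_on (coord \<psi> ` (dom_of \<phi> \<inter> dom_of \<psi>)) (transition \<psi> \<phi>)"

text \<open>A smooth structure is a maximal smooth atlas.\<close>

definition smooth_structure ::
  "('m::{t2_space, second_countable_topology}, 'e::euclidean_space) chart set \<Rightarrow> bool" where
  "smooth_structure A \<longleftrightarrow>
     (\<forall>\<phi>\<in>A. is_chart \<phi>) \<and>
     (\<Union>\<phi>\<in>A. dom_of \<phi>) = UNIV \<and>
     (\<forall>\<phi>\<in>A. \<forall>\<psi>\<in>A. compatible \<phi> \<psi>) \<and>
     (\<forall>\<phi>. is_chart \<phi> \<and> (\<forall>\<psi>\<in>A. compatible \<phi> \<psi>) \<longrightarrow> \<phi> \<in> A)"


section \<open>Vector fields and Lorentz metrics\<close>

text \<open>A tangent vector at \<open>p\<close> is given by its components in the charts around \<open>p\<close>, related by the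
  derivatives of the transition maps. Accordingly a vector field, a metric or a connection is a
  family of local expressions, indexed by the charts of the atlas and depending on the coordinates,
  that obeys the respective transformation law.\<close>

type_synonym ('m, 'e) vfield = "('m, 'e) chart \<Rightarrow> 'e \<Rightarrow> 'e"
type_synonym ('m, 'e) metric = "('m, 'e) chart \<Rightarrow> 'e \<Rightarrow> 'e \<Rightarrow> 'e \<Rightarrow> real"
type_synonym ('m, 'e) connection = "('m, 'e) chart \<Rightarrow> 'e \<Rightarrow> 'e \<Rightarrow> 'e \<Rightarrow> 'e"

definition vector_field ::
  "('m::topological_space, 'e::euclidean_space) chart set \<Rightarrow> ('m, 'e) vfield \<Rightarrow> bool" where
  "vector_field A X \<longleftrightarrow>
     (\<forall>\<phi>\<in>A. smooth_on (img_of \<phi>) (X \<phi>)) \<and>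
     (\<forall>\<phi>\<in>A. \<forall>\<psi>\<in>A. \<forall>p\<in>dom_of \<phi> \<inter> dom_of \<psi>.
        X \<psi> (coord \<psi> p) = frechet_derivative (transition \<phi> \<psi>) (at (coord \<phi> p)) (X \<phi> (coord \<phi> p)))"

text \<open>Symmetric bilinear forms of signature \<open>(+,\<dots>,+,-)\<close>.\<close>

definition lorentz_form :: "('e::euclidean_space \<Rightarrow> 'e \<Rightarrow> real) \<Rightarrow> bool" where
  "lorentz_form B \<longleftrightarrow> bilinear B \<and> (\<forall>u v. B u v = B v u) \<and>
     (\<exists>e::nat \<Rightarrow> 'e. \<forall>i<DIM('e). \<forall>j<DIM('e).
        B (e i) (e j) = (if i \<noteq> j then 0 else if Suc i = DIM('e) then -1 else 1))"

definition lorentz_metric ::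
  "('m::topological_space, 'e::euclidean_space) chart set \<Rightarrow> ('m, 'e) metric \<Rightarrow> bool" where
  "lorentz_metric A g \<longleftrightarrow>
     (\<forall>\<phi>\<in>A. \<forall>u v. smooth_on (img_of \<phi>) (\<lambda>x. g \<phi> x u v)) \<and>
     (\<forall>\<phi>\<in>A. \<forall>x\<in>img_of \<phi>. lorentz_form (g \<phi> x)) \<and>
     (\<forall>\<phi>\<in>A. \<forall>\<psi>\<in>A. \<forall>p\<in>dom_of \<phi> \<inter> dom_of \<psi>. \<forall>u v.
        g \<phi> (coord \<phi> p) u v =
        g \<psi> (coord \<psi> p) (frechet_derivative (transition \<phi> \<psi>) (at (coord \<phi> p)) u)
                        (frechet_derivative (transition \<phi> \<psi>) (at (coord \<phi> p)) v))"


section \<open>The Levi-Civita connection\<close>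

text \<open>A connection is given by its Christoffel maps \<open>\<Gamma> \<phi> x (u, v)\<close>: in a chart,
  \<open>\<nabla>\<^sub>X Y = DY(X) + \<Gamma>(X, Y)\<close>. In the following definitions \<open>X\<close>, \<open>Y\<close>, \<open>Z\<close> are local vector fields
  on the image of the chart \<open>\<phi>\<close>.\<close>

definition cov_deriv ::
  "('m, 'e::euclidean_space) connection \<Rightarrow> ('m, 'e) chart \<Rightarrow> ('e \<Rightarrow> 'e) \<Rightarrow> ('e \<Rightarrow> 'e) \<Rightarrow> 'e \<Rightarrow> 'e" where
  "cov_deriv \<Gamma> \<phi> X Y = (\<lambda>x. frechet_derivative Y (at x) (X x) + \<Gamma> \<phi> x (X x) (Y x))"

definition lie_bracket :: "('e::euclidean_space \<Rightarrow> 'e) \<Rightarrow> ('e \<Rightarrow> 'e) \<Rightarrow> 'e \<Rightarrow> 'e" where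
  "lie_bracket X Y = (\<lambda>x. frechet_derivative Y (at x) (X x) - frechet_derivative X (at x) (Y x))"

text \<open>The transformation law below, with the second derivative of the transition map \<open>\<tau>\<close>, says
  exactly that the local expressions of \<open>\<nabla>\<^sub>X Y\<close> in different charts define the same vector field.\<close>

definition affine_connection ::
  "('m::topological_space, 'e::euclidean_space) chart set \<Rightarrow> ('m, 'e) connection \<Rightarrow> bool" where
  "affine_connection A \<Gamma> \<longleftrightarrow>
     (\<forall>\<phi>\<in>A. \<forall>u v. smooth_on (img_of \<phi>) (\<lambda>x. \<Gamma> \<phi> x u v)) \<and>
     (\<forall>\<phi>\<in>A. \<forall>x\<in>img_of \<phi>. bilinear (\<Gamma> \<phi> x)) \<and>
     (\<forall>\<phi>\<in>A. \<forall>\<psi>\<in>A. \<forall>p\<in>dom_of \<phi> \<inter> dom_of \<psi>. \<forall>u v.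
        let \<tau> = transition \<phi> \<psi>; x = coord \<phi> p; D = frechet_derivative \<tau> (at x) in
          D (\<Gamma> \<phi> x u v) =
          frechet_derivative (\<lambda>y. frechet_derivative \<tau> (at y) v) (at x) u
            + \<Gamma> \<psi> (coord \<psi> p) (D u) (D v))"

definition torsion_free ::
  "('m::topological_space, 'e::euclidean_space) chart set \<Rightarrow> ('m, 'e) connection \<Rightarrow> bool" where
  "torsion_free A \<Gamma> \<longleftrightarrow>
     (\<forall>\<phi>\<in>A. \<forall>X Y. smooth_on (img_of \<phi>) X \<and> smooth_on (img_of \<phi>) Y \<longrightarrow>
        (\<forall>x\<in>img_of \<phi>. cov_deriv \<Gamma> \<phi> X Y x - cov_deriv \<Gamma> \<phi> Y X x = lie_bracket X Y x))"

definition metric_connection ::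
  "('m::topological_space, 'e::euclidean_space) chart set \<Rightarrow> ('m, 'e) metric \<Rightarrow>
   ('m, 'e) connection \<Rightarrow> bool" where
  "metric_connection A g \<Gamma> \<longleftrightarrow>
     (\<forall>\<phi>\<in>A. \<forall>X Y Z. smooth_on (img_of \<phi>) X \<and> smooth_on (img_of \<phi>) Y \<and> smooth_on (img_of \<phi>) Z \<longrightarrow>
        (\<forall>x\<in>img_of \<phi>.
           frechet_derivative (\<lambda>y. g \<phi> y (Y y) (Z y)) (at x) (X x) =
           g \<phi> x (cov_deriv \<Gamma> \<phi> X Y x) (Z x) + g \<phi> x (Y x) (cov_deriv \<Gamma> \<phi> X Z x)))"

definition levi_civita ::
  "('m::topological_space, 'e::euclidean_space) chart set \<Rightarrow> ('m, 'e) metric \<Rightarrow>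
   ('m, 'e) connection \<Rightarrow> bool" where
  "levi_civita A g \<Gamma> \<longleftrightarrow> affine_connection A \<Gamma> \<and> torsion_free A \<Gamma> \<and> metric_connection A g \<Gamma>"


section \<open>Curvature and geodesics\<close>

definition curvature ::
  "('m, 'e::euclidean_space) connection \<Rightarrow> ('m, 'e) chart \<Rightarrow>
   ('e \<Rightarrow> 'e) \<Rightarrow> ('e \<Rightarrow> 'e) \<Rightarrow> ('e \<Rightarrow> 'e) \<Rightarrow> 'e \<Rightarrow> 'e" where
  "curvature \<Gamma> \<phi> X Y Z = (\<lambda>x.
     cov_deriv \<Gamma> \<phi> X (cov_deriv \<Gamma> \<phi> Y Z) x
     - cov_deriv \<Gamma> \<phi> Y (cov_deriv \<Gamma> \<phi> X Z) x
     - cov_deriv \<Gamma> \<phi> (lie_bracket X Y) Z x)"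

text \<open>By tensoriality, \<open>R(u, v)w\<close> at a point is computed with the constant local extensions of \<open>u\<close>,
  \<open>v\<close>, \<open>w\<close>. With these signs the round sphere and de Sitter space have positive curvature.\<close>

definition sectional_curvature ::
  "('m, 'e::euclidean_space) metric \<Rightarrow> ('m, 'e) connection \<Rightarrow> ('m, 'e) chart \<Rightarrow> 'e \<Rightarrow> 'e \<Rightarrow> 'e \<Rightarrow> real"
where
  "sectional_curvature g \<Gamma> \<phi> x u v =
     g \<phi> x (curvature \<Gamma> \<phi> (\<lambda>_. u) (\<lambda>_. v) (\<lambda>_. v) x) u
     / (g \<phi> x u u * g \<phi> x v v - (g \<phi> x u v)\<^sup>2)"

text \<open>The sectional curvature is defined for nondegenerate tangent planes only, i.e. where the
  denominator above does not vanish.\<close>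

definition constant_sectional_curvature ::
  "('m::topological_space, 'e::euclidean_space) chart set \<Rightarrow> ('m, 'e) metric \<Rightarrow>
   ('m, 'e) connection \<Rightarrow> real \<Rightarrow> bool" where
  "constant_sectional_curvature A g \<Gamma> c \<longleftrightarrow>
     (\<forall>\<phi>\<in>A. \<forall>x\<in>img_of \<phi>. \<forall>u v. g \<phi> x u u * g \<phi> x v v - (g \<phi> x u v)\<^sup>2 \<noteq> 0 \<longrightarrow>
        sectional_curvature g \<Gamma> \<phi> x u v = c)"

definition smooth_curve ::
  "('m::topological_space, 'e::euclidean_space) chart set \<Rightarrow> (real \<Rightarrow> 'm) \<Rightarrow> bool" where
  "smooth_curve A \<gamma> \<longleftrightarrow>
     continuous_on UNIV \<gamma> \<and> (\<forall>\<phi>\<in>A. smooth_on (\<gamma> -` dom_of \<phi>) (coord \<phi> \<circ> \<gamma>))"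

definition velocity ::
  "('m, 'e::euclidean_space) chart \<Rightarrow> (real \<Rightarrow> 'm) \<Rightarrow> real \<Rightarrow> 'e" where
  "velocity \<phi> \<gamma> t = vector_derivative (coord \<phi> \<circ> \<gamma>) (at t)"

definition geodesic ::
  "('m::topological_space, 'e::euclidean_space) chart set \<Rightarrow> ('m, 'e) connection \<Rightarrow>
   (real \<Rightarrow> 'm) \<Rightarrow> bool" where
  "geodesic A \<Gamma> \<gamma> \<longleftrightarrow> smooth_curve A \<gamma> \<and>
     (\<forall>\<phi>\<in>A. \<forall>t. \<gamma> t \<in> dom_of \<phi> \<longrightarrow>
        vector_derivative (velocity \<phi> \<gamma>) (at t)
        + \<Gamma> \<phi> (coord \<phi> (\<gamma> t)) (velocity \<phi> \<gamma> t) (velocity \<phi> \<gamma> t) = 0)"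

text \<open>Every initial velocity at every point is that of a geodesic defined for all times.\<close>

definition geodesically_complete ::
  "('m::topological_space, 'e::euclidean_space) chart set \<Rightarrow> ('m, 'e) connection \<Rightarrow> bool" where
  "geodesically_complete A \<Gamma> \<longleftrightarrow>
     (\<forall>\<phi>\<in>A. \<forall>p\<in>dom_of \<phi>. \<forall>v. \<exists>\<gamma>. geodesic A \<Gamma> \<gamma> \<and> \<gamma> 0 = p \<and> velocity \<phi> \<gamma> 0 = v)"


section \<open>Codimension-one foliations\<close>

text \<open>A decomposition into path-connected leaves such that around every point there is a chart in
  which the components of the intersections with the leaves (the plaques) are the slices on which
  one distinguished coordinate is constant. Path-connectedness, rather than connectedness in the
  subspace topology, excludes unions of several dense leaves.\<close>

definition foliation_chart ::
  "'m::topological_space set set \<Rightarrow> ('m, 'e::euclidean_space) chart \<Rightarrow> bool" where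
  "foliation_chart F \<phi> \<longleftrightarrow>
     (\<exists>b\<in>Basis. \<forall>L\<in>F. \<forall>P\<in>components (L \<inter> dom_of \<phi>).
        \<exists>a. P = {q \<in> dom_of \<phi>. coord \<phi> q \<bullet> b = a})"

definition foliation_codim1 ::
  "('m::topological_space, 'e::euclidean_space) chart set \<Rightarrow> 'm set set \<Rightarrow> bool" where
  "foliation_codim1 A F \<longleftrightarrow>
     partition_on UNIV F \<and> (\<forall>L\<in>F. path_connected L) \<and>
     (\<forall>p. \<exists>\<phi>\<in>A. p \<in> dom_of \<phi> \<and> foliation_chart F \<phi>)"

text \<open>Components in the chart \<open>\<phi>\<close> of the vectors tangent at \<open>p\<close> to the leaf through \<open>p\<close>.\<close>

definition leaf_tangent ::
  "('m::topological_space, 'e::euclidean_space) chart set \<Rightarrow> 'm set set \<Rightarrow> ('m, 'e) chart \<Rightarrow>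
   'm \<Rightarrow> 'e set" where
  "leaf_tangent A F \<phi> p =
     {velocity \<phi> \<gamma> 0 | \<gamma>. smooth_curve A \<gamma> \<and> \<gamma> 0 = p \<and> (\<exists>L\<in>F. range \<gamma> \<subseteq> L)}"

definition spacelike_foliation ::
  "('m::topological_space, 'e::euclidean_space) chart set \<Rightarrow> ('m, 'e) metric \<Rightarrow> 'm set set \<Rightarrow> bool"
where
  "spacelike_foliation A g F \<longleftrightarrow> foliation_codim1 A F \<and>
     (\<forall>\<phi>\<in>A. \<forall>p\<in>dom_of \<phi>. \<forall>v\<in>leaf_tangent A F \<phi> p. v \<noteq> 0 \<longrightarrow> g \<phi> (coord \<phi> p) v v > 0)"

definition unit_timelike ::
  "('m::topological_space, 'e::euclidean_space) chart set \<Rightarrow> ('m, 'e) metric \<Rightarrow>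
   ('m, 'e) vfield \<Rightarrow> bool" where
  "unit_timelike A g N \<longleftrightarrow> (\<forall>\<phi>\<in>A. \<forall>x\<in>img_of \<phi>. g \<phi> x (N \<phi> x) (N \<phi> x) = -1)"

definition normal_to_leaves ::
  "('m::topological_space, 'e::euclidean_space) chart set \<Rightarrow> ('m, 'e) metric \<Rightarrow> 'm set set \<Rightarrow>
   ('m, 'e) vfield \<Rightarrow> bool" where
  "normal_to_leaves A g F N \<longleftrightarrow>
     (\<forall>\<phi>\<in>A. \<forall>p\<in>dom_of \<phi>. \<forall>v\<in>leaf_tangent A F \<phi> p.
        g \<phi> (coord \<phi> p) (N \<phi> (coord \<phi> p)) v = 0)"

definition geodesic_flow ::
  "('m::topological_space, 'e::euclidean_space) chart set \<Rightarrow> ('m, 'e) connection \<Rightarrow>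
   ('m, 'e) vfield \<Rightarrow> bool" where
  "geodesic_flow A \<Gamma> N \<longleftrightarrow> (\<forall>\<phi>\<in>A. \<forall>x\<in>img_of \<phi>. cov_deriv \<Gamma> \<phi> (N \<phi>) (N \<phi>) x = 0)"


section \<open>Mean curvature of the leaves\<close>

definition leaf_frame ::
  "('m::topological_space, 'e::euclidean_space) chart set \<Rightarrow> ('m, 'e) metric \<Rightarrow> 'm set set \<Rightarrow> nat \<Rightarrow>
   ('m, 'e) chart \<Rightarrow> 'm \<Rightarrow> (nat \<Rightarrow> 'e) \<Rightarrow> bool" where
  "leaf_frame A g F n \<phi> p e \<longleftrightarrow>
     (\<forall>i\<in>{1..n}. e i \<in> leaf_tangent A F \<phi> p) \<and>
     (\<forall>i\<in>{1..n}. \<forall>j\<in>{1..n}. g \<phi> (coord \<phi> p) (e i) (e j) = (if i = j then 1 else 0))"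

text \<open>\<open>h\<^sub>i\<^sub>j = - g(\<nabla>\<^bsub>e\<^sub>j\<^esub> N, e\<^sub>i)\<close>; only the values of the frame at \<open>p\<close> enter.\<close>

definition second_form ::
  "('m, 'e::euclidean_space) metric \<Rightarrow> ('m, 'e) connection \<Rightarrow> ('m, 'e) vfield \<Rightarrow> ('m, 'e) chart \<Rightarrow>
   'm \<Rightarrow> (nat \<Rightarrow> 'e) \<Rightarrow> nat \<Rightarrow> nat \<Rightarrow> real" where
  "second_form g \<Gamma> N \<phi> p e i j =
     - g \<phi> (coord \<phi> p) (cov_deriv \<Gamma> \<phi> (\<lambda>_. e j) (N \<phi>) (coord \<phi> p)) (e i)"

text \<open>The common value obtained from all charts around \<open>p\<close> and all orthonormal frames.\<close>

definition mean_curvature ::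
  "('m::topological_space, 'e::euclidean_space) chart set \<Rightarrow> ('m, 'e) metric \<Rightarrow>
   ('m, 'e) connection \<Rightarrow> 'm set set \<Rightarrow> ('m, 'e) vfield \<Rightarrow> nat \<Rightarrow> 'm \<Rightarrow> real" where
  "mean_curvature A g \<Gamma> F N n p =
     (THE H. \<exists>\<phi>\<in>A. \<exists>e. p \<in> dom_of \<phi> \<and> leaf_frame A g F n \<phi> p e \<and>
        H = - (1 / real n) * (\<Sum>i=1..n. second_form g \<Gamma> N \<phi> p e i i))"

end

theory Submission
  imports Defs
begin

text \<open>
Let \<open>S v = \<nabla>\<^sub>v N\<close>. Since \<open>N\<close> is a unit field with \<open>\<nabla>\<^sub>N N = 0\<close>, the endomorphism \<open>S\<close> annihilates \<open>N\<close>
and maps into the orthogonal complement of \<open>N\<close>, which is the tangent space of the leaf; its trace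
\<open>\<theta>\<close> is therefore \<open>n H\<close>. Two facts carry the proof.

\<^item> Raychaudhuri's equation (\<open>raychaudhuri\<close>): \<open>N(\<theta>) = - tr (v \<mapsto> R(v, N) N) - tr S\<^sup>2\<close>. In constant
  curvature \<open>c\<close> the first term is \<open>n c\<close>, because \<open>g(R(v, N) N, v) = - c\<close> for every unit vector \<open>v\<close>
  tangent to a leaf. Since \<open>N\<close> is normal to a foliation, \<open>S\<close> is self-adjoint on the leaves, so that
  \<open>tr S\<^sup>2\<close> is a sum of squares and \<open>n tr S\<^sup>2 \<ge> \<theta>\<^sup>2\<close> (\<open>trace_square_ge\<close>). Together these give the
  Riccati inequality \<open>N(H) \<le> c - H\<^sup>2\<close> (\<open>mean_curvature_riccati\<close>).

\<^item> By completeness there is a geodesic, defined for all times, with initial velocity \<open>N\<close>, and it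
  stays an integral curve of \<open>N\<close> (\<open>geodesic_is_integral_curve\<close>): its defect \<open>\<gamma>' - N\<close> satisfies a
  homogeneous linear differential equation. Along it \<open>h = H \<circ> \<gamma>\<close> satisfies \<open>h' \<le> c - h\<^sup>2\<close> on the
  whole real line, and a value with \<open>h\<^sup>2 > c\<close> would force \<open>h\<close> to be unbounded in finite time
  (\<open>riccati_global_bound\<close>). Hence \<open>H\<^sup>2 \<le> c\<close> everywhere, and in particular \<open>c \<ge> 0\<close>.

All tensors are computed in charts. The trace \<open>\<theta>\<close> is taken over the standard basis of the model
space, which makes it differentiable without choosing a moving frame; evaluating it in an
orthonormal frame (\<open>trace_in_dual_frame\<close>) shows that it does not depend on the chart and equals
\<open>n H\<close>.
\<close>

section \<open>Differential inequalities\<close>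

text \<open>A function that decreases wherever it lies below \<open>k\<close> cannot climb back: at the first time
\<open>r\<close> at which it would reach a level \<open>d\<close> with \<open>h s < d < k\<close>, it has stayed below \<open>k\<close> up to \<open>r\<close>, and
the mean value theorem contradicts the growth from \<open>h s\<close> to \<open>d\<close>.\<close>

lemma decreasing_below_barrier:
  fixes h h' :: "real \<Rightarrow> real"
  assumes h: "\<And>t. (h has_real_derivative h' t) (at t)"
    and below: "\<And>t. h t < k \<Longrightarrow> h' t \<le> 0"
    and "h s < k" "s \<le> t"
  shows "h t \<le> h s"
proof (rule ccontr)
  assume "\<not> h t \<le> h s"
  then obtain d where d: "h s < d" "d < k" "d \<le> h t"
    using \<open>h s < k\<close> dense[of "h s" "min k (h t)"] by auto
  have cont: "continuous_on UNIV h"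
    using h by (meson DERIV_continuous_on has_field_derivative_at_within)
  define C where "C = {r \<in> {s..t}. d \<le> h r}"
  have C: "compact C" "C \<noteq> {}"
  proof -
    have "C = {s..t} \<inter> h -` {d..}" by (auto simp: C_def)
    moreover have "closed (h -` {d..})"
      by (rule closed_vimage[OF closed_atLeast cont])
    ultimately show "compact C" by (simp add: compact_Int_closed)
    show "C \<noteq> {}" using d \<open>s \<le> t\<close> by (auto simp: C_def)
  qed
  then obtain r where r: "r \<in> C" "\<And>q. q \<in> C \<Longrightarrow> r \<le> q"
    using compact_attains_inf[OF C] by auto
  have "s \<le> r" "d \<le> h r" using r(1) by (auto simp: C_def)
  then have "s < r" using d(1) by (cases "s = r") auto
  obtain z where z: "s < z" "z < r" "h r - h s = (r - s) * h' z"
    using MVT2[OF \<open>s < r\<close> h] by blast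
  have "z \<notin> C" using r(2)[of z] z(2) by auto
  then have "h z < d" using r(1) z by (auto simp: C_def)
  then have "(r - s) * h' z \<le> 0"
    using below[of z] d \<open>s < r\<close> by (simp add: mult_nonneg_nonpos)
  then show False using z r(1) d by (auto simp: C_def)
qed

text \<open>Once \<open>h < - k\<close>, the function decreases forever, and \<open>y = 1 / (- h - k)\<close> is positive with
\<open>y' \<le> - 1\<close>, which is impossible beyond the time \<open>s + y s\<close>.\<close>

lemma riccati_lower_bound:
  fixes h h' :: "real \<Rightarrow> real"
  assumes h: "\<And>t. (h has_real_derivative h' t) (at t)"
    and riccati: "\<And>t. h' t \<le> k\<^sup>2 - (h t)\<^sup>2"
    and "k \<ge> 0"
  shows "- k \<le> h s"
proof (rule ccontr)
  assume "\<not> - k \<le> h s"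
  then have s: "h s < - k" by simp
  have neg: "h t < - k \<Longrightarrow> h' t \<le> 0" for t
  proof -
    assume "h t < - k"
    then have "k\<^sup>2 \<le> (h t)\<^sup>2" using \<open>k \<ge> 0\<close> by (intro abs_le_square_iff[THEN iffD1]) auto
    with riccati[of t] show ?thesis by simp
  qed
  have below: "h t < - k" if "s \<le> t" for t
    using decreasing_below_barrier[OF h neg s that] s by simp
  define y where "y t = inverse (- h t - k)" for t
  have y: "(y has_real_derivative h' t * (inverse (- h t - k))\<^sup>2) (at t)" if "s \<le> t" for t
    unfolding y_def using below[OF that]
    by (auto intro!: derivative_eq_intros h simp: power2_eq_square)
  have decay: "h' t * (inverse (- h t - k))\<^sup>2 \<le> - 1" if "s \<le> t" for t
  proof -
    have p: "0 < - h t - k" using below[OF that] by simp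
    have "k\<^sup>2 - (h t)\<^sup>2 = - ((- h t - k)\<^sup>2) - 2 * k * (- h t - k)"
      by (simp add: power2_eq_square algebra_simps)
    then have "h' t \<le> - ((- h t - k)\<^sup>2)"
      using riccati[of t] p \<open>k \<ge> 0\<close> mult_nonneg_nonneg[of k "- h t - k"] by linarith
    then have "h' t * (inverse (- h t - k))\<^sup>2 \<le> - ((- h t - k)\<^sup>2) * (inverse (- h t - k))\<^sup>2"
      by (rule mult_right_mono) simp
    also have "\<dots> = - 1" using p by (simp add: field_simps)
    finally show ?thesis .
  qed
  have ypos: "y t > 0" if "s \<le> t" for t
    using below[OF that] by (simp add: y_def)
  define t where "t = s + y s"
  have "s < t" using ypos[of s] by (simp add: t_def)
  obtain z where z: "s < z" "z < t"
      "y t - y s = (t - s) * (h' z * (inverse (- h z - k))\<^sup>2)"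
    using MVT2[OF \<open>s < t\<close>, of y "\<lambda>z. h' z * (inverse (- h z - k))\<^sup>2"] y by force
  then have "y t - y s \<le> (t - s) * (- 1)"
    using mult_left_mono[OF decay[of z], of "t - s"] \<open>s < t\<close> by linarith
  then show False using ypos[of t] \<open>s < t\<close> by (simp add: t_def)
qed

text \<open>The upper bound is the lower bound for the time reversal \<open>t \<mapsto> - h (- t)\<close>, which satisfies the same
inequality. If \<open>c < 0\<close>, the inequality with \<open>0\<close> in place of \<open>c\<close> forces \<open>h = 0\<close>, contradicting
\<open>h' \<le> c\<close>.\<close>

lemma riccati_global_bound:
  fixes h h' :: "real \<Rightarrow> real"
  assumes h: "\<And>t. (h has_real_derivative h' t) (at t)"
    and riccati: "\<And>t. h' t \<le> c - (h t)\<^sup>2"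
  shows "(h s)\<^sup>2 \<le> c"
proof -
  have bound: "(h s)\<^sup>2 \<le> k\<^sup>2" if k: "\<And>t. h' t \<le> k\<^sup>2 - (h t)\<^sup>2" "k \<ge> 0" for k s
  proof -
    have "- k \<le> h s" by (rule riccati_lower_bound[OF h k])
    moreover have "- k \<le> - h (- (- s))"
    proof (rule riccati_lower_bound[where h = "\<lambda>t. - h (- t)" and h' = "\<lambda>t. h' (- t)"])
      show "((\<lambda>t. - h (- t)) has_real_derivative h' (- t)) (at t)" for t
        by (auto intro!: derivative_eq_intros DERIV_chain2[OF h])
      show "h' (- t) \<le> k\<^sup>2 - (- h (- t))\<^sup>2" for t using k(1)[of "- t"] by simp
    qed (rule k)
    ultimately show ?thesis
      by (intro abs_le_square_iff[THEN iffD1]) auto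
  qed
  have "c \<ge> 0"
  proof (rule ccontr)
    assume "\<not> c \<ge> 0"
    have "(h t)\<^sup>2 \<le> 0\<^sup>2" for t
    proof (rule bound)
      show "h' t \<le> 0\<^sup>2 - (h t)\<^sup>2" for t using riccati[of t] \<open>\<not> c \<ge> 0\<close> by simp
    qed simp
    then have "h = (\<lambda>_. 0)" by (simp add: fun_eq_iff)
    then have "h' 0 = 0" using DERIV_unique[OF h[of 0], of 0] by simp
    then show False using riccati[of 0] \<open>\<not> c \<ge> 0\<close> zero_le_power2[of "h 0"] by linarith
  qed
  then show ?thesis using bound[of "sqrt c"] riccati by simp
qed

text \<open>Gronwall's argument: with \<open>u = w \<bullet> w\<close> the assumption gives \<open>\<bar>u'\<bar> \<le> 2 K u\<close>, so \<open>u exp (- 2 K t)\<close> is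
nonincreasing after \<open>t0\<close> and \<open>u exp (2 K t)\<close> is nondecreasing before \<open>t0\<close>.\<close>

lemma linear_growth_zero:
  fixes w w' :: "real \<Rightarrow> 'a::real_inner"
  assumes w: "\<And>t. t \<in> ball t0 r \<Longrightarrow> (w has_vector_derivative w' t) (at t)"
    and growth: "\<And>t. t \<in> ball t0 r \<Longrightarrow> norm (w' t) \<le> K * norm (w t)"
    and "w t0 = 0" and t: "t \<in> ball t0 r"
  shows "w t = 0"
proof -
  define u where "u s = w s \<bullet> w s" for s
  have u: "(u has_real_derivative 2 * (w s \<bullet> w' s)) (at s)" if "s \<in> ball t0 r" for s
    using has_derivative_inner[OF w[OF that, unfolded has_vector_derivative_def]
      w[OF that, unfolded has_vector_derivative_def]]
    unfolding u_def has_field_derivative_def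
    by (rule has_derivative_eq_rhs) (simp add: fun_eq_iff inner_commute algebra_simps)
  have est: "\<bar>2 * (w s \<bullet> w' s)\<bar> \<le> 2 * K * u s" if "s \<in> ball t0 r" for s
  proof -
    have "\<bar>w s \<bullet> w' s\<bar> \<le> norm (w s) * norm (w' s)" by (rule Cauchy_Schwarz_ineq2)
    also have "\<dots> \<le> norm (w s) * (K * norm (w s))"
      using growth[OF that] by (simp add: mult_left_mono)
    finally show ?thesis by (simp add: u_def dot_square_norm power2_eq_square mult_ac abs_mult)
  qed
  have D: "((\<lambda>s. u s * exp (a * s)) has_real_derivative
      (2 * (w s \<bullet> w' s) + a * u s) * exp (a * s)) (at s)" if "s \<in> ball t0 r" for s a
    using u[OF that] by (auto intro!: derivative_eq_intros simp: algebra_simps)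
  have sub: "s \<in> ball t0 r" if "min t0 t \<le> s" "s \<le> max t0 t" for s
    using t that by (auto simp: dist_real_def)
  have "u t * exp (a * t) \<le> 0" if a: "a = (if t0 \<le> t then - 2 * K else 2 * K)" for a
  proof (cases "t0 \<le> t")
    case True
    have "u t * exp (a * t) \<le> u t0 * exp (a * t0)"
    proof (rule DERIV_nonpos_imp_nonincreasing[OF True])
      fix s assume "t0 \<le> s" "s \<le> t"
      then have s: "s \<in> ball t0 r" using sub[of s] by simp
      show "\<exists>y. ((\<lambda>s. u s * exp (a * s)) has_real_derivative y) (at s) \<and> y \<le> 0"
        using est[OF s] a True
        by (intro exI[of _ "(2 * (w s \<bullet> w' s) + a * u s) * exp (a * s)"] conjI D[OF s]) (auto simp: mult_le_0_iff)
    qed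
    then show ?thesis using \<open>w t0 = 0\<close> by (simp add: u_def)
  next
    case False
    then have "t \<le> t0" by simp
    have "u t * exp (a * t) \<le> u t0 * exp (a * t0)"
    proof (rule DERIV_nonneg_imp_nondecreasing[OF \<open>t \<le> t0\<close>])
      fix s assume "t \<le> s" "s \<le> t0"
      then have s: "s \<in> ball t0 r" using sub[of s] False by simp
      show "\<exists>y. ((\<lambda>s. u s * exp (a * s)) has_real_derivative y) (at s) \<and> 0 \<le> y"
        using est[OF s] a False
        by (intro exI[of _ "(2 * (w s \<bullet> w' s) + a * u s) * exp (a * s)"] conjI D[OF s]) (auto simp: zero_le_mult_iff)
    qed
    then show ?thesis using \<open>w t0 = 0\<close> by (simp add: u_def)
  qed
  then have "u t \<le> 0" by (simp add: mult_le_0_iff not_le[symmetric])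
  then have "w t \<bullet> w t = 0" using inner_ge_zero[of "w t"] unfolding u_def by linarith
  then show ?thesis by simp
qed

section \<open>Smooth maps and fields of linear maps\<close>

lemma Ck_on_const: "Ck_on k S (\<lambda>_. c)"
  by (induction k arbitrary: c) auto

lemma smooth_on_const: "smooth_on S (\<lambda>_. c)"
  by (simp add: smooth_on_def Ck_on_const)

lemma smooth_on_imp_differentiable: "smooth_on S f \<Longrightarrow> x \<in> S \<Longrightarrow> f differentiable (at x)"
  unfolding smooth_on_def by (metis Ck_on.simps(2))

lemma frechet_derivative_locally_const:
  assumes "open S" "x \<in> S" "\<And>y. y \<in> S \<Longrightarrow> f y = k"
  shows "frechet_derivative f (at x) v = 0"
proof -
  have "(f has_derivative (\<lambda>_. 0)) (at x)"
    by (rule has_derivative_transform_within_open[OF has_derivative_const[of k] assms(1,2)])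
      (simp add: assms(3))
  then show ?thesis using frechet_derivative_at by metis
qed

lemma smooth_on_frechet_derivative:
  "smooth_on S f \<Longrightarrow> smooth_on S (\<lambda>x. frechet_derivative f (at x) v)"
  unfolding smooth_on_def by (metis Ck_on.simps(2))

lemma smooth_on_continuous: "smooth_on S f \<Longrightarrow> continuous_on S f"
  unfolding smooth_on_def by (metis Ck_on.simps(1))

lemma smooth_on_has_derivative:
  "smooth_on S f \<Longrightarrow> x \<in> S \<Longrightarrow> (f has_derivative frechet_derivative f (at x)) (at x)"
  using smooth_on_imp_differentiable frechet_derivative_works by blast

text \<open>Openness makes the derivatives of two functions that agree on \<open>S\<close> agree there too.\<close>

lemma Ck_on_cong:
  assumes "open S" "\<And>x. x \<in> S \<Longrightarrow> f x = g x" "Ck_on k S f"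
  shows "Ck_on k S g"
  using assms
proof (induction k arbitrary: f g)
  case 0 then show ?case using continuous_on_cong by (metis Ck_on.simps(1))
next
  case (Suc k)
  have der: "(g has_derivative frechet_derivative f (at x)) (at x)" if "x \<in> S" for x
    using has_derivative_transform_within_open[of f _ x UNIV S g] Suc.prems that
    by (auto simp: frechet_derivative_works[symmetric])
  then have eq: "frechet_derivative g (at x) = frechet_derivative f (at x)" if "x \<in> S" for x
    using frechet_derivative_at that by metis
  have "Ck_on k S (\<lambda>x. frechet_derivative g (at x) v)" for v
    using Suc.IH[of "\<lambda>x. frechet_derivative f (at x) v" "\<lambda>x. frechet_derivative g (at x) v"]
      Suc.prems eq by simp
  then show ?case using der by (auto simp: differentiable_def)
qed

lemma Ck_on_Suc_imp: "Ck_on (Suc k) S f \<Longrightarrow> Ck_on k S f"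
proof (induction k arbitrary: f)
  case 0
  then show ?case
    by (auto intro!: continuous_at_imp_continuous_on differentiable_imp_continuous_within)
next
  case (Suc k) then show ?case by (metis Ck_on.simps(2))
qed

lemma Ck_on_add:
  assumes "open S" "Ck_on k S f" "Ck_on k S g"
  shows "Ck_on k S (\<lambda>x. f x + g x)"
  using assms(2,3)
proof (induction k arbitrary: f g)
  case 0 then show ?case by (simp add: continuous_on_add)
next
  case (Suc k)
  have der: "((\<lambda>x. f x + g x) has_derivative
      (\<lambda>v. frechet_derivative f (at x) v + frechet_derivative g (at x) v)) (at x)" if "x \<in> S" for x
    using Suc.prems that by (auto intro!: has_derivative_add simp: frechet_derivative_works[symmetric])
  have "Ck_on k S (\<lambda>x. frechet_derivative (\<lambda>x. f x + g x) (at x) v)" for v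
    by (rule Ck_on_cong[OF \<open>open S\<close> _ Suc.IH])
      (use Suc.prems frechet_derivative_at[OF der] in \<open>auto simp: fun_eq_iff\<close>)
  then show ?case using der by (auto simp: differentiable_def)
qed

lemma Ck_on_scaleR:
  assumes "open S" "Ck_on k S a" "Ck_on k S f"
  shows "Ck_on k S (\<lambda>x. a x *\<^sub>R f x)"
  using assms(2,3)
proof (induction k arbitrary: a f)
  case 0 then show ?case by (simp add: continuous_on_scaleR)
next
  case (Suc k)
  have der: "((\<lambda>x. a x *\<^sub>R f x) has_derivative
      (\<lambda>v. a x *\<^sub>R frechet_derivative f (at x) v + frechet_derivative a (at x) v *\<^sub>R f x)) (at x)"
    if "x \<in> S" for x
    using Suc.prems that by (auto intro!: has_derivative_scaleR simp: frechet_derivative_works[symmetric])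
  have "Ck_on k S a" "Ck_on k S f" using Suc.prems Ck_on_Suc_imp by blast+
  note lower = this
  have "Ck_on k S (\<lambda>x. frechet_derivative (\<lambda>x. a x *\<^sub>R f x) (at x) v)" for v
  proof (rule Ck_on_cong[OF \<open>open S\<close>])
    show "Ck_on k S (\<lambda>x. a x *\<^sub>R frechet_derivative f (at x) v + frechet_derivative a (at x) v *\<^sub>R f x)"
      using Suc.prems lower by (intro Ck_on_add[OF \<open>open S\<close>] Suc.IH) auto
  qed (use frechet_derivative_at[OF der] in \<open>auto simp: fun_eq_iff\<close>)
  then show ?case using der by (auto simp: differentiable_def)
qed

text \<open>The product rule for a tensor field applied to a vector field. The field \<open>L\<close> of linear maps is only
known to be differentiable on each fixed vector, so both sides are expanded in the standard basis.\<close>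

lemma has_derivative_linear_field:
  fixes L :: "'a::real_normed_vector \<Rightarrow> 'e::euclidean_space \<Rightarrow> 'b::real_normed_vector"
  assumes S: "open S" "x \<in> S" and lin: "\<And>y. y \<in> S \<Longrightarrow> linear (L y)"
    and L: "\<And>v. ((\<lambda>y. L y v) has_derivative L' v) (at x)"
    and a: "(a has_derivative a') (at x)"
  shows "((\<lambda>y. L y (a y)) has_derivative (\<lambda>h. L' (a x) h + L x (a' h))) (at x)"
proof -
  have rep: "L y v = (\<Sum>b\<in>Basis. (v \<bullet> b) *\<^sub>R L y b)" if "y \<in> S" for y v
  proof -
    have "L y (\<Sum>b\<in>Basis. (v \<bullet> b) *\<^sub>R b) = (\<Sum>b\<in>Basis. (v \<bullet> b) *\<^sub>R L y b)"
      by (simp only: linear_sum[OF lin[OF that]] linear_scale[OF lin[OF that]])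
    then show ?thesis by (simp add: euclidean_representation)
  qed
  have rep': "L' v h = (\<Sum>b\<in>Basis. (v \<bullet> b) *\<^sub>R L' b h)" for v h
  proof -
    have "((\<lambda>y. \<Sum>b\<in>Basis. (v \<bullet> b) *\<^sub>R L y b) has_derivative
        (\<lambda>h. \<Sum>b\<in>Basis. (v \<bullet> b) *\<^sub>R L' b h)) (at x)"
      by (intro has_derivative_sum has_derivative_scaleR_right L)
    then have "((\<lambda>y. L y v) has_derivative (\<lambda>h. \<Sum>b\<in>Basis. (v \<bullet> b) *\<^sub>R L' b h)) (at x)"
      by (rule has_derivative_transform_within_open[OF _ S]) (simp add: rep[symmetric])
    then show ?thesis using has_derivative_unique[OF L] by metis
  qed
  have "((\<lambda>y. \<Sum>b\<in>Basis. (a y \<bullet> b) *\<^sub>R L y b) has_derivative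
      (\<lambda>h. \<Sum>b\<in>Basis. (a x \<bullet> b) *\<^sub>R L' b h + (a' h \<bullet> b) *\<^sub>R L x b)) (at x)"
    by (intro has_derivative_sum has_derivative_scaleR L has_derivative_inner_left a)
  then have "((\<lambda>y. \<Sum>b\<in>Basis. (a y \<bullet> b) *\<^sub>R L y b) has_derivative
      (\<lambda>h. L' (a x) h + L x (a' h))) (at x)"
    by (simp add: sum.distrib rep'[symmetric] rep[OF S(2), symmetric])
  then show ?thesis
    by (rule has_derivative_transform_within_open[OF _ S]) (simp add: rep[symmetric])
qed

lemma linear_field_derivative_linear:
  fixes L :: "'a::real_normed_vector \<Rightarrow> 'e::real_vector \<Rightarrow> 'b::real_normed_vector"
  assumes S: "open S" "x \<in> S" and lin: "\<And>y. y \<in> S \<Longrightarrow> linear (L y)"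
    and L: "\<And>v. ((\<lambda>y. L y v) has_derivative L' v) (at x)"
  shows "linear (\<lambda>v. L' v h)"
proof (rule linearI)
  fix u v :: 'e and c :: real
  have "((\<lambda>y. L y (u + v)) has_derivative (\<lambda>h. L' u h + L' v h)) (at x)"
    by (rule has_derivative_transform_within_open[OF has_derivative_add[OF L L] S])
      (simp add: linear_add[OF lin])
  then show "L' (u + v) h = L' u h + L' v h" using has_derivative_unique[OF L] by metis
  have "((\<lambda>y. L y (c *\<^sub>R u)) has_derivative (\<lambda>h. c *\<^sub>R L' u h)) (at x)"
    by (rule has_derivative_transform_within_open[OF has_derivative_scaleR_right[OF L] S])
      (simp add: linear_scale[OF lin])
  then show "L' (c *\<^sub>R u) h = c *\<^sub>R L' u h" using has_derivative_unique[OF L] by metis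
qed

text \<open>The linear product rule, used once in each argument.\<close>

lemma has_derivative_bilinear_field:
  fixes B :: "'a::real_normed_vector \<Rightarrow> 'e::euclidean_space \<Rightarrow> 'e \<Rightarrow> 'b::real_normed_vector"
  assumes S: "open S" "x \<in> S" and bilin: "\<And>y. y \<in> S \<Longrightarrow> bilinear (B y)"
    and B: "\<And>u v. ((\<lambda>y. B y u v) has_derivative B' u v) (at x)"
    and a: "(a has_derivative a') (at x)" and b: "(b has_derivative b') (at x)"
  shows "((\<lambda>y. B y (a y) (b y)) has_derivative
    (\<lambda>h. B' (a x) (b x) h + B x (a x) (b' h) + B x (a' h) (b x))) (at x)"
proof (rule has_derivative_linear_field[OF S _ _ a])
  show "linear (\<lambda>u. B y u (b y))" if "y \<in> S" for y using bilin[OF that] by (simp add: bilinear_def)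
  show "((\<lambda>y. B y u (b y)) has_derivative (\<lambda>h. B' u (b x) h + B x u (b' h))) (at x)" for u
    by (rule has_derivative_linear_field[OF S _ B b]) (use bilin in \<open>simp add: bilinear_def\<close>)
qed

lemma has_derivative_along_line:
  fixes f :: "'a::real_normed_vector \<Rightarrow> 'b::real_normed_vector"
  assumes "(f has_derivative f') (at (x + t *\<^sub>R u))"
  shows "((\<lambda>t. f (x + t *\<^sub>R u)) has_vector_derivative f' u) (at t)"
proof -
  have line: "((\<lambda>t. x + t *\<^sub>R u) has_derivative (\<lambda>h. h *\<^sub>R u)) (at t)"
    by (auto intro!: derivative_eq_intros)
  have "((\<lambda>t. f (x + t *\<^sub>R u)) has_derivative (\<lambda>h. f' (h *\<^sub>R u))) (at t)"
    by (rule has_derivative_compose[OF line assms])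
  then show ?thesis
    using linear_scale[OF has_derivative_linear[OF assms]] by (simp add: has_vector_derivative_def)
qed

text \<open>One application of the mean value theorem in each of the two directions expresses the second
difference as a mixed derivative at an intermediate point.\<close>

lemma second_difference_mean_value:
  fixes f :: "'a::real_normed_vector \<Rightarrow> real"
  assumes f: "\<And>y. y \<in> ball x r \<Longrightarrow> f differentiable (at y)"
    and fu: "\<And>y. y \<in> ball x r \<Longrightarrow> (\<lambda>z. frechet_derivative f (at z) u) differentiable (at y)"
    and d: "0 < d" "d * (norm u + norm v) < r"
  shows "\<exists>y\<in>ball x r. f (x + d *\<^sub>R u + d *\<^sub>R v) - f (x + d *\<^sub>R u) - f (x + d *\<^sub>R v) + f x =
    d\<^sup>2 * frechet_derivative (\<lambda>z. frechet_derivative f (at z) u) (at y) v"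
proof -
  have mem: "x + s *\<^sub>R u + t *\<^sub>R v \<in> ball x r" if "0 \<le> s" "s \<le> d" "0 \<le> t" "t \<le> d" for s t
  proof -
    have "norm (s *\<^sub>R u + t *\<^sub>R v) \<le> s * norm u + t * norm v"
      using norm_triangle_ineq[of "s *\<^sub>R u" "t *\<^sub>R v"] that by simp
    also have "\<dots> \<le> d * norm u + d * norm v"
      using that by (intro add_mono mult_right_mono) auto
    finally have "norm (s *\<^sub>R u + t *\<^sub>R v) < r" using d by (simp add: algebra_simps)
    then show ?thesis
      by (simp add: dist_norm add.assoc norm_minus_commute) (simp add: add.commute)
  qed
  have f': "(f has_derivative frechet_derivative f (at y)) (at y)" if "y \<in> ball x r" for y
    using f[OF that] by (simp add: frechet_derivative_works[symmetric])
  define G where "G s = f ((x + d *\<^sub>R v) + s *\<^sub>R u) - f (x + s *\<^sub>R u)" for s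
  define G' where "G' s = frechet_derivative f (at ((x + d *\<^sub>R v) + s *\<^sub>R u)) u
      - frechet_derivative f (at (x + s *\<^sub>R u)) u" for s
  have "(G has_real_derivative G' s) (at s)" if "0 \<le> s" "s \<le> d" for s
    unfolding G_def G'_def has_real_derivative_iff_has_vector_derivative
    using mem[OF that, of d] mem[OF that, of 0] d
    by (intro has_vector_derivative_diff has_derivative_along_line f') (auto simp: algebra_simps)
  then obtain s where s: "0 < s" "s < d" "G d - G 0 = (d - 0) * G' s"
    using MVT2[OF d(1), of G G'] by auto
  define K where "K t = frechet_derivative f (at ((x + s *\<^sub>R u) + t *\<^sub>R v)) u" for t
  define K' where "K' t = frechet_derivative (\<lambda>z. frechet_derivative f (at z) u)
      (at ((x + s *\<^sub>R u) + t *\<^sub>R v)) v" for t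
  have "(K has_real_derivative K' t) (at t)" if "0 \<le> t" "t \<le> d" for t
    unfolding K_def K'_def has_real_derivative_iff_has_vector_derivative
    using fu[OF mem[of s t]] s that
    by (intro has_derivative_along_line) (simp add: frechet_derivative_works[symmetric])
  then obtain t where t: "0 < t" "t < d" "K d - K 0 = (d - 0) * K' t"
    using MVT2[OF d(1), of K K'] by auto
  have "G' s = K d - K 0" by (simp add: G'_def K_def algebra_simps)
  then have "G d - G 0 = d\<^sup>2 * K' t" using s t by (simp add: power2_eq_square)
  moreover have "G d - G 0 = f (x + d *\<^sub>R u + d *\<^sub>R v) - f (x + d *\<^sub>R u) - f (x + d *\<^sub>R v) + f x"
    by (simp add: G_def algebra_simps)
  ultimately show ?thesis using mem[of s t] s t by (auto simp: K'_def)
qed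

text \<open>The second difference is symmetric in \<open>u\<close> and \<open>v\<close>. Hence the two mixed derivatives agree at points
arbitrarily near to \<open>x\<close>, and their continuity gives the equality at \<open>x\<close>.\<close>

lemma second_derivative_symmetric_real:
  fixes f :: "'a::real_normed_vector \<Rightarrow> real"
  assumes S: "open S" "x \<in> S" and f: "smooth_on S f"
  shows "frechet_derivative (\<lambda>y. frechet_derivative f (at y) u) (at x) v =
    frechet_derivative (\<lambda>y. frechet_derivative f (at y) v) (at x) u"
proof (rule ccontr)
  define P where "P u v y = frechet_derivative (\<lambda>y. frechet_derivative f (at y) u) (at y) v" for u v y
  assume "\<not> ?thesis"
  then have "0 < dist (P u v x) (P v u x) / 2" (is "0 < ?d") by (simp add: P_def)
  have cont: "continuous (at x) (P u v)" for u v
    using smooth_on_continuous[OF smooth_on_frechet_derivative[OF smooth_on_frechet_derivative[OF f]]]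
      S continuous_on_eq_continuous_at unfolding P_def by blast
  have "\<exists>r>0. \<forall>y\<in>ball x r. dist (P u v y) (P u v x) < ?d" for u v
    using cont[of u v, unfolded continuous_at_eps_delta, rule_format, OF \<open>0 < ?d\<close>]
    by (auto simp: dist_commute)
  then obtain r1 r2 where r12: "r1 > 0" "r2 > 0" "\<And>y. y \<in> ball x r1 \<Longrightarrow> dist (P u v y) (P u v x) < ?d"
      "\<And>y. y \<in> ball x r2 \<Longrightarrow> dist (P v u y) (P v u x) < ?d"
    by metis
  obtain r3 where r3: "r3 > 0" "ball x r3 \<subseteq> S" using S open_contains_ball by blast
  define r where "r = min r1 (min r2 r3)"
  have "r > 0" using r12 r3 by (simp add: r_def)
  define d where "d = r / (norm u + norm v + 1)"
  have pos: "norm u + norm v + 1 > 0" by (simp add: add_nonneg_pos)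
  have d: "d > 0" "d * (norm u + norm v) < r" "d * (norm v + norm u) < r"
    using \<open>r > 0\<close> pos by (auto simp: d_def field_simps)
  have diff: "f differentiable (at y)" "(\<lambda>z. frechet_derivative f (at z) w) differentiable (at y)"
    if "y \<in> ball x r" for y w
    using that r3 by (auto intro!: smooth_on_imp_differentiable[of S] smooth_on_frechet_derivative f simp: r_def)
  obtain y1 where y1: "y1 \<in> ball x r"
      "f (x + d *\<^sub>R u + d *\<^sub>R v) - f (x + d *\<^sub>R u) - f (x + d *\<^sub>R v) + f x = d\<^sup>2 * P u v y1"
    using second_difference_mean_value[OF diff d(1,2)] unfolding P_def by blast
  obtain y2 where y2: "y2 \<in> ball x r"
      "f (x + d *\<^sub>R v + d *\<^sub>R u) - f (x + d *\<^sub>R v) - f (x + d *\<^sub>R u) + f x = d\<^sup>2 * P v u y2"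
    using second_difference_mean_value[OF diff d(1,3)] unfolding P_def by blast
  have "d\<^sup>2 * P u v y1 = d\<^sup>2 * P v u y2" using y1(2) y2(2) by (simp add: algebra_simps)
  then have "P u v y1 = P v u y2" using d by simp
  moreover have "dist (P u v y1) (P u v x) < ?d" "dist (P v u y2) (P v u x) < ?d"
    using r12 y1(1) y2(1) by (auto simp: r_def)
  ultimately show False by (smt (verit) dist_commute dist_triangle field_sum_of_halves)
qed

lemma smooth_on_inner:
  assumes "open S" "smooth_on S f"
  shows "smooth_on S (\<lambda>x. f x \<bullet> b)"
proof -
  have "Ck_on k S f \<Longrightarrow> Ck_on k S (\<lambda>x. f x \<bullet> b)" for k
  proof (induction k arbitrary: f)
    case 0 then show ?case by (simp add: continuous_on_inner)
  next
    case (Suc k)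
    have der: "((\<lambda>x. f x \<bullet> b) has_derivative (\<lambda>v. frechet_derivative f (at x) v \<bullet> b)) (at x)"
      if "x \<in> S" for x
      using Suc.prems that
      by (auto intro!: has_derivative_inner_left simp: frechet_derivative_works[symmetric])
    have "Ck_on k S (\<lambda>x. frechet_derivative (\<lambda>x. f x \<bullet> b) (at x) v)" for v
      by (rule Ck_on_cong[OF \<open>open S\<close> _ Suc.IH])
        (use Suc.prems frechet_derivative_at[OF der] in \<open>auto simp: fun_eq_iff\<close>)
    then show ?case using der by (auto simp: differentiable_def)
  qed
  then show ?thesis using assms by (simp add: smooth_on_def)
qed

lemma second_derivative_symmetric:
  fixes f :: "'a::real_normed_vector \<Rightarrow> 'b::euclidean_space"
  assumes S: "open S" "x \<in> S" and f: "smooth_on S f"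
  shows "frechet_derivative (\<lambda>y. frechet_derivative f (at y) u) (at x) v =
    frechet_derivative (\<lambda>y. frechet_derivative f (at y) v) (at x) u"
proof (rule euclidean_eqI)
  fix b :: 'b
  define fb where "fb = (\<lambda>y. f y \<bullet> b)"
  have fb: "smooth_on S fb" unfolding fb_def by (rule smooth_on_inner[OF S(1) f])
  have 1: "frechet_derivative fb (at y) w = frechet_derivative f (at y) w \<bullet> b" if "y \<in> S" for y w
    using frechet_derivative_at[OF has_derivative_inner_left[OF smooth_on_has_derivative[OF f that], of b]]
    by (simp add: fb_def fun_eq_iff)
  have "frechet_derivative (\<lambda>y. frechet_derivative fb (at y) w) (at x) z =
      frechet_derivative (\<lambda>y. frechet_derivative f (at y) w) (at x) z \<bullet> b" for w z
  proof -
    have "((\<lambda>y. frechet_derivative f (at y) w \<bullet> b) has_derivative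
        (\<lambda>z. frechet_derivative (\<lambda>y. frechet_derivative f (at y) w) (at x) z \<bullet> b)) (at x)"
      by (intro has_derivative_inner_left smooth_on_has_derivative[OF smooth_on_frechet_derivative[OF f] S(2)])
    then have "((\<lambda>y. frechet_derivative fb (at y) w) has_derivative
        (\<lambda>z. frechet_derivative (\<lambda>y. frechet_derivative f (at y) w) (at x) z \<bullet> b)) (at x)"
      by (rule has_derivative_transform_within_open[OF _ S]) (simp add: 1)
    from frechet_derivative_at[OF this] show ?thesis by (simp add: fun_eq_iff)
  qed
  then show "frechet_derivative (\<lambda>y. frechet_derivative f (at y) u) (at x) v \<bullet> b =
    frechet_derivative (\<lambda>y. frechet_derivative f (at y) v) (at x) u \<bullet> b"
    using second_derivative_symmetric_real[OF S fb, of u v] by simp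
qed

text \<open>By the chain rule the derivative of the composition is \<open>s'\<close> times a directional derivative of \<open>f\<close>
along the same line, so the induction needs products but no general chain rule of order \<open>k\<close>.\<close>

lemma smooth_on_compose_curve:
  fixes f :: "'a::real_normed_vector \<Rightarrow> 'b::real_normed_vector"
  assumes U: "open U" and s: "smooth_on U s" and maps: "\<And>t. t \<in> U \<Longrightarrow> x + s t *\<^sub>R v \<in> S"
    and f: "smooth_on S f"
  shows "smooth_on (U::real set) (\<lambda>t. f (x + s t *\<^sub>R v))"
proof -
  have "Ck_on k S f \<Longrightarrow> Ck_on k U (\<lambda>t. f (x + s t *\<^sub>R v))" for k
  proof (induction k arbitrary: f)
    case 0
    have "continuous_on U (\<lambda>t. x + s t *\<^sub>R v)"
      using smooth_on_continuous[OF s] by (intro continuous_intros)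
    then show ?case using 0 maps
      by (auto intro!: continuous_on_compose2[of S f])
  next
    case (Suc k)
    have der: "((\<lambda>t. f (x + s t *\<^sub>R v)) has_derivative
        (\<lambda>h. frechet_derivative s (at t) h *\<^sub>R frechet_derivative f (at (x + s t *\<^sub>R v)) v)) (at t)"
      if "t \<in> U" for t
    proof -
      have f': "(f has_derivative frechet_derivative f (at (x + s t *\<^sub>R v))) (at (x + s t *\<^sub>R v))"
        using Suc.prems maps[OF that] by (simp add: frechet_derivative_works[symmetric])
      have "((\<lambda>t. x + s t *\<^sub>R v) has_derivative (\<lambda>h. frechet_derivative s (at t) h *\<^sub>R v)) (at t)"
        using smooth_on_has_derivative[OF s that] by (auto intro!: derivative_eq_intros)
      from has_derivative_compose[OF this f'] show ?thesis
        by (simp add: linear_scale[OF has_derivative_linear[OF f']])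
    qed
    have "Ck_on k U (\<lambda>t. frechet_derivative (\<lambda>t. f (x + s t *\<^sub>R v)) (at t) h)" for h
    proof (rule Ck_on_cong[OF U])
      show "Ck_on k U (\<lambda>t. frechet_derivative s (at t) h *\<^sub>R frechet_derivative f (at (x + s t *\<^sub>R v)) v)"
        using Suc.prems smooth_on_frechet_derivative[OF s, of h]
        by (intro Ck_on_scaleR[OF U] Suc.IH) (auto simp: smooth_on_def)
    qed (use frechet_derivative_at[OF der] in \<open>auto simp: fun_eq_iff\<close>)
    then show ?case using der by (auto simp: differentiable_def)
  qed
  then show ?thesis using f by (simp add: smooth_on_def)
qed

lemma Ck_on_sin_cos:
  "Ck_on k S (\<lambda>t::real. a * sin (b * t))" "Ck_on k S (\<lambda>t::real. a * cos (b * t))"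
proof (induction k arbitrary: a)
  case 0
  case 1 then show ?case by (auto intro!: continuous_intros)
  case 2 then show ?case by (auto intro!: continuous_intros)
next
  case (Suc k)
  have s: "((\<lambda>t. a * sin (b * t)) has_derivative (\<lambda>h. (a * b * h) * cos (b * t))) (at t)" for a t
    by (auto intro!: derivative_eq_intros)
  have c: "((\<lambda>t. a * cos (b * t)) has_derivative (\<lambda>h. (- a * b * h) * sin (b * t))) (at t)" for a t
    by (auto intro!: derivative_eq_intros)
  have "(\<lambda>t. a * sin (b * t)) differentiable (at t)" "(\<lambda>t. a * cos (b * t)) differentiable (at t)" for a t
    using s c unfolding differentiable_def by blast+
  note diff = this
  case 1 show ?case
    unfolding Ck_on.simps frechet_derivative_at[OF s, symmetric]
    by (intro conjI ballI allI diff Suc)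
  case 2 show ?case
    unfolding Ck_on.simps frechet_derivative_at[OF c, symmetric]
    by (intro conjI ballI allI diff Suc)
qed

section \<open>Traces in orthonormal frames of a Lorentz form\<close>

text \<open>Duality makes the \<open>w i\<close> independent, and there are as many of them as the dimension.\<close>

lemma identity_in_dual_frame:
  fixes w :: "'i \<Rightarrow> 'e::euclidean_space" and \<alpha> :: "'i \<Rightarrow> 'e \<Rightarrow> real"
  assumes I: "finite I" "card I = DIM('e)"
    and lin: "\<And>i. i \<in> I \<Longrightarrow> linear (\<alpha> i)"
    and dual: "\<And>i j. i \<in> I \<Longrightarrow> j \<in> I \<Longrightarrow> \<alpha> i (w j) = (if i = j then 1 else 0)"
  shows "x = (\<Sum>i\<in>I. \<alpha> i x *\<^sub>R w i)"
proof -
  have inj: "inj_on w I"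
    using dual by (metis inj_onI zero_neq_one)
  have coeff: "\<alpha> j (\<Sum>i\<in>I. c i *\<^sub>R w i) = c j" if "j \<in> I" for j c
  proof -
    have "\<alpha> j (\<Sum>i\<in>I. c i *\<^sub>R w i) = (\<Sum>i\<in>I. c i * (if j = i then 1 else 0))"
      using that dual by (simp add: linear_sum[OF lin[OF that]] linear_scale[OF lin[OF that]])
    also have "\<dots> = c j" using that I by (simp add: if_distrib sum.delta cong: if_cong)
    finally show ?thesis .
  qed
  have "independent (w ` I)"
  proof (rule independent_if_scalars_zero)
    show "finite (w ` I)" using I by simp
    fix f v assume f: "(\<Sum>v\<in>w ` I. f v *\<^sub>R v) = 0" and "v \<in> w ` I"
    then obtain j where j: "j \<in> I" "v = w j" by auto
    have "(\<Sum>i\<in>I. f (w i) *\<^sub>R w i) = 0" using f by (simp add: sum.reindex[OF inj] o_def)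
    then have "f (w j) = \<alpha> j 0" using coeff[OF j(1), of "\<lambda>i. f (w i)"] by simp
    then show "f v = 0" using j linear_0[OF lin[OF j(1)]] by simp
  qed
  moreover have "card (w ` I) = DIM('e)" using I inj by (simp add: card_image)
  ultimately have "span (w ` I) = UNIV"
    using dim_eq_full[of "w ` I"] dim_eq_card_independent[of "w ` I"] by simp
  then have "x \<in> span (w ` I)" by simp
  then obtain c where c: "x = (\<Sum>v\<in>w ` I. c v *\<^sub>R v)"
    using I span_finite[of "w ` I"] by auto
  then have x: "x = (\<Sum>i\<in>I. c (w i) *\<^sub>R w i)" by (simp add: sum.reindex[OF inj] o_def)
  have "\<alpha> j x = c (w j)" if "j \<in> I" for j
    using coeff[OF that, of "\<lambda>i. c (w i)"] x by simp
  then show ?thesis using x by simp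
qed

definition endo_trace :: "('e::euclidean_space \<Rightarrow> 'e) \<Rightarrow> real" where
  "endo_trace T = (\<Sum>b\<in>Basis. T b \<bullet> b)"

lemma trace_in_dual_frame:
  fixes w :: "'i \<Rightarrow> 'e::euclidean_space" and \<alpha> :: "'i \<Rightarrow> 'e \<Rightarrow> real"
  assumes I: "finite I" "card I = DIM('e)"
    and lin: "\<And>i. i \<in> I \<Longrightarrow> linear (\<alpha> i)"
    and dual: "\<And>i j. i \<in> I \<Longrightarrow> j \<in> I \<Longrightarrow> \<alpha> i (w j) = (if i = j then 1 else 0)"
    and T: "linear T"
  shows "endo_trace T = (\<Sum>i\<in>I. \<alpha> i (T (w i)))"
proof -
  have "endo_trace T = (\<Sum>b\<in>Basis. T (\<Sum>i\<in>I. \<alpha> i b *\<^sub>R w i) \<bullet> b)"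
    unfolding endo_trace_def using identity_in_dual_frame[OF I lin dual] by simp
  also have "\<dots> = (\<Sum>i\<in>I. \<Sum>b\<in>Basis. (T (w i) \<bullet> b) * \<alpha> i b)"
    by (simp add: linear_sum[OF T] linear_scale[OF T] inner_sum_left mult.commute) (rule sum.swap)
  also have "\<dots> = (\<Sum>i\<in>I. \<alpha> i (\<Sum>b\<in>Basis. (T (w i) \<bullet> b) *\<^sub>R b))"
    by (intro sum.cong refl) (simp add: linear_sum[OF lin] linear_scale[OF lin])
  finally show ?thesis by (simp add: euclidean_representation)
qed

lemma trace_mult_commute:
  fixes S T :: "'e::euclidean_space \<Rightarrow> 'e"
  assumes S: "linear S" and T: "linear T"
  shows "endo_trace (\<lambda>v. S (T v)) = endo_trace (\<lambda>v. T (S v))"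
proof -
  have expand: "U (V b) \<bullet> b = (\<Sum>b'\<in>Basis. (V b \<bullet> b') * (U b' \<bullet> b))"
    if "linear U" for U V :: "'e \<Rightarrow> 'e" and b
  proof -
    have "U (V b) = U (\<Sum>b'\<in>Basis. (V b \<bullet> b') *\<^sub>R b')" by (simp add: euclidean_representation)
    then show ?thesis
      by (simp only: linear_sum[OF that] linear_scale[OF that] inner_sum_left inner_scaleR_left)
  qed
  show ?thesis
    unfolding endo_trace_def expand[OF S, of T] expand[OF T, of S]
    by (subst sum.swap) (simp add: mult.commute)
qed

text \<open>The Gram--Schmidt process for a form that is positive definite only on the subspace \<open>V\<close>.\<close>

lemma orthonormal_frame_exists:
  fixes B :: "'e::euclidean_space \<Rightarrow> 'e \<Rightarrow> real"
  assumes B: "bilinear B" and sym: "\<And>u v. B u v = B v u"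
    and V: "subspace V" and pos: "\<And>v. v \<in> V \<Longrightarrow> v \<noteq> 0 \<Longrightarrow> B v v > 0"
    and "k \<le> dim V"
  shows "\<exists>e::nat \<Rightarrow> 'e. (\<forall>i\<in>{1..k}. e i \<in> V) \<and>
    (\<forall>i\<in>{1..k}. \<forall>j\<in>{1..k}. B (e i) (e j) = (if i = j then 1 else 0))"
  using \<open>k \<le> dim V\<close>
proof (induction k)
  case (Suc k)
  from Suc.IH[OF Suc_leD[OF Suc.prems]] obtain e :: "nat \<Rightarrow> 'e" where frame: "\<forall>i\<in>{1..k}. e i \<in> V"
      "\<forall>i\<in>{1..k}. \<forall>j\<in>{1..k}. B (e i) (e j) = (if i = j then 1 else 0)"
    by (elim exE conjE) (rule that)
  note e = frame(1)[rule_format] frame(2)[rule_format]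
  have "dim (span (e ` {1..k})) \<le> card (e ` {1..k})" by (simp add: dim_le_card')
  also have "\<dots> \<le> k" using card_image_le[of "{1..k}" e] by simp
  finally have "\<not> V \<subseteq> span (e ` {1..k})" using Suc.prems dim_subset[of V "span (e ` {1..k})"] by auto
  then obtain v where v: "v \<in> V" "v \<notin> span (e ` {1..k})" by auto
  define u where "u = v - (\<Sum>i=1..k. B v (e i) *\<^sub>R e i)"
  have "(\<Sum>i=1..k. B v (e i) *\<^sub>R e i) \<in> span (e ` {1..k})"
    by (intro span_sum span_scale span_base) auto
  then have "u \<noteq> 0" using v(2) by (auto simp: u_def)
  have uV: "u \<in> V" unfolding u_def using e(1) v(1)
    by (intro subspace_diff[OF V] subspace_sum[OF V] subspace_scale[OF V]) auto
  have ue: "B u (e j) = 0" if j: "j \<in> {1..k}" for j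
  proof -
    have lin: "linear (\<lambda>x. B x (e j))" using B by (simp add: bilinear_def)
    have "B u (e j) = B v (e j) - (\<Sum>i=1..k. B v (e i) * B (e i) (e j))"
      unfolding u_def by (simp add: linear_diff[OF lin] linear_sum[OF lin] linear_scale[OF lin])
    also have "(\<Sum>i=1..k. B v (e i) * B (e i) (e j)) = (\<Sum>i=1..k. if i = j then B v (e i) else 0)"
      by (rule sum.cong) (auto simp: e(2)[OF _ j])
    finally show ?thesis using j by simp
  qed
  define a where "a = 1 / sqrt (B u u)"
  have a: "a * (a * B u u) = 1"
    using pos[OF uV \<open>u \<noteq> 0\<close>] by (simp add: a_def field_simps)
  define e' where "e' = e(Suc k := a *\<^sub>R u)"
  have "\<forall>i\<in>{1..Suc k}. e' i \<in> V"
    using e(1) uV by (auto simp: e'_def intro: subspace_scale[OF V])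
  moreover have "B (e' i) (e' j) = (if i = j then 1 else 0)" if "i \<in> {1..Suc k}" "j \<in> {1..Suc k}" for i j
  proof -
    have "i = Suc k \<or> i \<in> {1..k}" "j = Suc k \<or> j \<in> {1..k}" using that by auto
    then show ?thesis
      using e(2) ue a sym
      by (auto simp: e'_def bilinear_lmul[OF B] bilinear_rmul[OF B] bilinear_rzero[OF B])
  qed
  ultimately show ?case by blast
qed simp

text \<open>An orthonormal basis of signature \<open>(+,\<dots>,+,-)\<close> whose timelike member is \<open>\<nu>\<close>.\<close>

locale lorentz_frame =
  fixes B :: "'e::euclidean_space \<Rightarrow> 'e \<Rightarrow> real" and n :: nat and e :: "nat \<Rightarrow> 'e" and \<nu> :: 'e
  assumes dim: "DIM('e) = n + 1"
    and bilin: "bilinear B"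
    and sym: "B u v = B v u"
    and ortho: "i \<in> {1..n} \<Longrightarrow> j \<in> {1..n} \<Longrightarrow> B (e i) (e j) = (if i = j then 1 else 0)"
    and unit: "B \<nu> \<nu> = - 1"
    and normal: "i \<in> {1..n} \<Longrightarrow> B \<nu> (e i) = 0"
begin

text \<open>The basis of the dual space that belongs to the frame; the index \<open>0\<close> stands for the timelike vector.\<close>

definition "covec i x = (if i = 0 then - B \<nu> x else B (e i) x)"

lemma dual_frame:
  shows "i \<in> {0..n} \<Longrightarrow> linear (covec i)"
    and "i \<in> {0..n} \<Longrightarrow> j \<in> {0..n} \<Longrightarrow>
      covec i (if j = 0 then \<nu> else e j) = (if i = j then 1 else 0)"
    and "finite {0..n}" "card {0..n} = DIM('e)"
proof -
  have lin: "linear (B u)" for u using bilin by (simp add: bilinear_def)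
  have "covec i = (if i = 0 then (\<lambda>x. - B \<nu> x) else B (e i))"
    by (auto simp: covec_def fun_eq_iff)
  then show "linear (covec i)" using lin linear_compose_neg[OF lin] by simp
  assume "i \<in> {0..n}" "j \<in> {0..n}"
  then show "covec i (if j = 0 then \<nu> else e j) = (if i = j then 1 else 0)"
    using ortho[of i j] normal[of i] normal[of j] unit sym[of "e i" \<nu>] by (auto simp: covec_def)
qed (simp_all add: dim)

lemma split_index: "(\<Sum>i\<in>{0..n}. f i) = f 0 + (\<Sum>i=1..n. f i)"
  by (simp add: sum.atLeast_Suc_atMost)

lemma expand: "x = (\<Sum>i=1..n. B x (e i) *\<^sub>R e i) - B x \<nu> *\<^sub>R \<nu>"
  using identity_in_dual_frame[of "{0..n}" covec "\<lambda>j. if j = 0 then \<nu> else e j", OF dual_frame(3,4,1,2), of x]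
  unfolding split_index by (simp add: covec_def sym)

lemma trace_eq:
  assumes "linear T"
  shows "endo_trace T = (\<Sum>i=1..n. B (T (e i)) (e i)) - B (T \<nu>) \<nu>"
  using trace_in_dual_frame[of "{0..n}" covec "\<lambda>j. if j = 0 then \<nu> else e j", OF dual_frame(3,4,1,2) assms]
  unfolding split_index by (simp add: covec_def sym)

text \<open>In the frame \<open>T\<close> is a symmetric matrix \<open>a\<close> on the complement of \<open>\<nu>\<close>, so \<open>tr T\<^sup>2\<close> is the sum of all
\<open>a\<^sub>i\<^sub>j\<^sup>2\<close>. It is at least the sum of the diagonal squares, to which the Cauchy--Schwarz inequality
applies.\<close>

lemma trace_square_ge:
  assumes T: "linear T" and ker: "T \<nu> = 0" and range: "\<And>v. B (T v) \<nu> = 0"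
    and self_adjoint: "\<And>i j. i \<in> {1..n} \<Longrightarrow> j \<in> {1..n} \<Longrightarrow> B (T (e i)) (e j) = B (T (e j)) (e i)"
  shows "(endo_trace T)\<^sup>2 \<le> n * endo_trace (\<lambda>v. T (T v))"
proof -
  have lin: "linear (\<lambda>x. B x v)" for v using bilin by (simp add: bilinear_def)
  have sq: "B (T (T (e i))) (e i) = (\<Sum>j=1..n. (B (T (e i)) (e j))\<^sup>2)" if i: "i \<in> {1..n}" for i
  proof -
    have "T (e i) = (\<Sum>j=1..n. B (T (e i)) (e j) *\<^sub>R e j)"
      using expand[of "T (e i)"] range by simp
    then have "B (T (T (e i))) (e i) = B (T (\<Sum>j=1..n. B (T (e i)) (e j) *\<^sub>R e j)) (e i)" by simp
    also have "\<dots> = (\<Sum>j=1..n. B (T (e i)) (e j) * B (T (e j)) (e i))"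
      by (simp add: linear_sum[OF T] linear_scale[OF T] linear_sum[OF lin] linear_scale[OF lin])
    also have "\<dots> = (\<Sum>j=1..n. (B (T (e i)) (e j))\<^sup>2)"
      by (rule sum.cong) (auto simp: power2_eq_square self_adjoint[OF _ i])
    finally show ?thesis .
  qed
  have "(endo_trace T)\<^sup>2 = (\<Sum>i=1..n. B (T (e i)) (e i))\<^sup>2"
    using trace_eq[OF T] ker bilinear_lzero[OF bilin] by simp
  also have "\<dots> \<le> n * (\<Sum>i=1..n. (B (T (e i)) (e i))\<^sup>2)"
    using sum_squared_le_sum_of_squares[of "\<lambda>i. B (T (e i)) (e i)" "{1..n}"]
    by (simp add: mult.commute)
  also have "\<dots> \<le> n * (\<Sum>i=1..n. B (T (T (e i))) (e i))"
  proof (intro mult_left_mono sum_mono)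
    fix i assume i: "i \<in> {1..n}"
    show "(B (T (e i)) (e i))\<^sup>2 \<le> B (T (T (e i))) (e i)"
      unfolding sq[OF i] by (rule member_le_sum[OF i]) auto
  qed simp
  also have "\<dots> = n * endo_trace (\<lambda>v. T (T v))"
    using trace_eq[OF linear_compose[OF T T]] ker linear_0[OF T] bilinear_lzero[OF bilin]
    by (simp add: o_def)
  finally show ?thesis .
qed

end

section \<open>Charts, curves and plaques\<close>

lemma is_chartD:
  assumes "is_chart \<phi>"
  shows chart_open_dom: "open (dom_of \<phi>)"
    and chart_open_img: "open (img_of \<phi>)"
    and chart_coord_in: "p \<in> dom_of \<phi> \<Longrightarrow> coord \<phi> p \<in> img_of \<phi>"
    and chart_inv_in: "x \<in> img_of \<phi> \<Longrightarrow> inv_coord \<phi> x \<in> dom_of \<phi>"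
    and chart_inv_coord: "p \<in> dom_of \<phi> \<Longrightarrow> inv_coord \<phi> (coord \<phi> p) = p"
    and chart_coord_inv: "x \<in> img_of \<phi> \<Longrightarrow> coord \<phi> (inv_coord \<phi> x) = x"
    and chart_continuous_inv: "continuous_on (img_of \<phi>) (inv_coord \<phi>)"
  using assms unfolding is_chart_def homeomorphism_def by auto

lemma open_overlap:
  assumes \<phi>: "is_chart \<phi>" and \<psi>: "is_chart \<psi>"
  shows "open (coord \<phi> ` (dom_of \<phi> \<inter> dom_of \<psi>))"
proof -
  have "coord \<phi> ` (dom_of \<phi> \<inter> dom_of \<psi>) = img_of \<phi> \<inter> inv_coord \<phi> -` dom_of \<psi>"
  proof (intro equalityI subsetI)
    fix x assume "x \<in> img_of \<phi> \<inter> inv_coord \<phi> -` dom_of \<psi>"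
    then show "x \<in> coord \<phi> ` (dom_of \<phi> \<inter> dom_of \<psi>)"
      using chart_inv_in[OF \<phi>] chart_coord_inv[OF \<phi>] by (intro image_eqI[of _ _ "inv_coord \<phi> x"]) auto
  qed (use chart_coord_in[OF \<phi>] chart_inv_coord[OF \<phi>] in auto)
  then show ?thesis
    using continuous_open_preimage[OF chart_continuous_inv[OF \<phi>] chart_open_img[OF \<phi>] chart_open_dom[OF \<psi>]]
    by simp
qed

lemma transition_coord:
  "is_chart \<phi> \<Longrightarrow> p \<in> dom_of \<phi> \<Longrightarrow> transition \<phi> \<psi> (coord \<phi> p) = coord \<psi> p"
  by (simp add: transition_def chart_inv_coord)

lemma smooth_structureD:
  assumes "smooth_structure A"
  shows "\<phi> \<in> A \<Longrightarrow> is_chart \<phi>"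
    and "\<phi> \<in> A \<Longrightarrow> \<psi> \<in> A \<Longrightarrow>
      smooth_on (coord \<phi> ` (dom_of \<phi> \<inter> dom_of \<psi>)) (transition \<phi> \<psi>)"
    and "\<exists>\<phi>\<in>A. p \<in> dom_of \<phi>"
proof -
  note A = assms[unfolded smooth_structure_def]
  note conjunct1[OF A] conjunct1[OF conjunct2[OF A]] conjunct1[OF conjunct2[OF conjunct2[OF A]]]
  then show "\<phi> \<in> A \<Longrightarrow> is_chart \<phi>"
    "\<phi> \<in> A \<Longrightarrow> \<psi> \<in> A \<Longrightarrow>
      smooth_on (coord \<phi> ` (dom_of \<phi> \<inter> dom_of \<psi>)) (transition \<phi> \<psi>)"
    "\<exists>\<phi>\<in>A. p \<in> dom_of \<phi>"
    unfolding compatible_def by blast+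
qed

lemma smooth_curve_open_preimage:
  assumes "is_chart \<phi>" "smooth_curve A \<gamma>"
  shows "open (\<gamma> -` dom_of \<phi>)"
  using assms by (auto simp: smooth_curve_def intro: open_vimage chart_open_dom)

lemma smooth_curve_has_velocity:
  assumes "\<phi> \<in> A" "smooth_curve A \<gamma>" "\<gamma> t \<in> dom_of \<phi>"
  shows "((\<lambda>t. coord \<phi> (\<gamma> t)) has_vector_derivative velocity \<phi> \<gamma> t) (at t)"
proof -
  have "smooth_on (\<gamma> -` dom_of \<phi>) (coord \<phi> \<circ> \<gamma>)" using assms by (simp add: smooth_curve_def)
  then have "(coord \<phi> \<circ> \<gamma>) differentiable (at t)"
    using assms(3) by (auto intro: smooth_on_imp_differentiable)
  then show ?thesis
    unfolding velocity_def by (simp add: vector_derivative_works[symmetric] o_def)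
qed

lemma smooth_curve_has_acceleration:
  assumes "is_chart \<phi>" "\<phi> \<in> A" "smooth_curve A \<gamma>" "\<gamma> t \<in> dom_of \<phi>"
  shows "(velocity \<phi> \<gamma> has_vector_derivative vector_derivative (velocity \<phi> \<gamma>) (at t)) (at t)"
proof -
  let ?U = "\<gamma> -` dom_of \<phi>" and ?c = "coord \<phi> \<circ> \<gamma>"
  have sm: "smooth_on ?U ?c" using assms by (simp add: smooth_curve_def)
  have "((\<lambda>s. frechet_derivative ?c (at s) 1) has_derivative
      frechet_derivative (\<lambda>s. frechet_derivative ?c (at s) 1) (at t)) (at t)"
    using assms by (intro smooth_on_has_derivative[OF smooth_on_frechet_derivative[OF sm]]) simp
  then have "(velocity \<phi> \<gamma> has_derivative
      frechet_derivative (\<lambda>s. frechet_derivative ?c (at s) 1) (at t)) (at t)"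
  proof (rule has_derivative_transform_within_open[OF _ smooth_curve_open_preimage[OF assms(1,3)]])
    show "frechet_derivative ?c (at s) 1 = velocity \<phi> \<gamma> s" if "s \<in> ?U" for s
      using frechet_derivative_eq_vector_derivative[OF smooth_on_imp_differentiable[OF sm that]]
      by (simp add: velocity_def)
  qed (use assms in simp)
  then have "velocity \<phi> \<gamma> differentiable (at t)" unfolding differentiable_def by blast
  then show ?thesis by (simp add: vector_derivative_works[symmetric])
qed

text \<open>For constant fields the Lie bracket vanishes and \<open>\<nabla>\<close> reduces to the Christoffel map.\<close>

lemma curvature_const_fields:
  assumes bilin: "bilinear (\<Gamma> \<phi> x)"
  shows "curvature \<Gamma> \<phi> (\<lambda>_. u) (\<lambda>_. v) (\<lambda>_. w) x =
    frechet_derivative (\<lambda>y. \<Gamma> \<phi> y v w) (at x) u + \<Gamma> \<phi> x u (\<Gamma> \<phi> x v w)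
    - frechet_derivative (\<lambda>y. \<Gamma> \<phi> y u w) (at x) v - \<Gamma> \<phi> x v (\<Gamma> \<phi> x u w)"
  by (simp add: curvature_def cov_deriv_def lie_bracket_def bilinear_lzero[OF bilin])

text \<open>A vector \<open>v\<close> tangent to the slices is the velocity of a curve in one plaque. Since curves in a leaf
are defined on the whole real line, the straight segment in direction \<open>v\<close> is traversed as
\<open>x + \<epsilon> sin (t / \<epsilon>) v\<close>: this stays within distance \<open>\<epsilon> \<bar>v\<bar>\<close> of \<open>x\<close>, hence in the chart, and has
velocity \<open>v\<close> at time \<open>0\<close>.\<close>

lemma slice_subset_leaf_tangent:
  fixes A :: "('m::{t2_space, second_countable_topology}, 'e::euclidean_space) chart set"
  assumes A: "smooth_structure A" and F: "partition_on UNIV F"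
    and \<phi>: "\<phi> \<in> A" and p: "p \<in> dom_of \<phi>" and v: "v \<bullet> b = 0"
    and slices: "\<forall>L\<in>F. \<forall>P\<in>components (L \<inter> dom_of \<phi>). \<exists>a. P = {q \<in> dom_of \<phi>. coord \<phi> q \<bullet> b = a}"
  shows "v \<in> leaf_tangent A F \<phi> p"
proof -
  have ch: "is_chart \<psi>" if "\<psi> \<in> A" for \<psi> using smooth_structureD(1)[OF A that] .
  define x where "x = coord \<phi> p"
  have "x \<in> img_of \<phi>" using chart_coord_in[OF ch[OF \<phi>] p] by (simp add: x_def)
  then obtain r where r: "r > 0" "ball x r \<subseteq> img_of \<phi>"
    using chart_open_img[OF ch[OF \<phi>]] open_contains_ball by blast
  define \<epsilon> where "\<epsilon> = r / (2 * (norm v + 1))"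
  have \<epsilon>: "\<epsilon> > 0" using r by (simp add: \<epsilon>_def add_nonneg_pos)
  define s where "s t = \<epsilon> * sin (inverse \<epsilon> * t)" for t :: real
  have s': "(s has_real_derivative 1) (at 0)"
    unfolding s_def using \<epsilon> by (auto intro!: derivative_eq_intros)
  have sm_s: "smooth_on U s" for U using Ck_on_sin_cos(1) unfolding smooth_on_def s_def by blast
  have in_img: "x + s t *\<^sub>R v \<in> img_of \<phi>" for t
  proof -
    have "norm (s t *\<^sub>R v) \<le> \<epsilon> * norm v"
      using \<epsilon> mult_right_mono[OF abs_sin_le_one[of "inverse \<epsilon> * t"], of "norm v"]
      by (simp add: s_def abs_mult)
    also have "\<dots> < r"
    proof -
      have "0 < norm v + 2" by (rule add_nonneg_pos) simp_all
      then have "norm v < 2 * (norm v + 1)" by simp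
      then have "r * norm v < r * (2 * (norm v + 1))" using r(1) by (rule mult_strict_left_mono)
      moreover have "0 < 2 * (norm v + 1)" by (simp add: add_nonneg_pos)
      ultimately show ?thesis by (simp only: \<epsilon>_def times_divide_eq_left pos_divide_less_eq)
    qed
    finally show ?thesis using r(2) by (auto simp: dist_norm)
  qed
  define \<gamma> where "\<gamma> t = inv_coord \<phi> (x + s t *\<^sub>R v)" for t
  have \<gamma>_dom: "\<gamma> t \<in> dom_of \<phi>" for t
    using chart_inv_in[OF ch[OF \<phi>] in_img] by (simp add: \<gamma>_def)
  have \<gamma>_coord: "coord \<phi> (\<gamma> t) = x + s t *\<^sub>R v" for t
    using chart_coord_inv[OF ch[OF \<phi>] in_img] by (simp add: \<gamma>_def)
  have \<gamma>0: "\<gamma> 0 = p" using chart_inv_coord[OF ch[OF \<phi>] p] by (simp add: \<gamma>_def s_def x_def)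
  have cont: "continuous_on UNIV \<gamma>"
  proof -
    have "continuous_on UNIV (\<lambda>t. x + s t *\<^sub>R v)"
      using smooth_on_continuous[OF sm_s, of UNIV] by (intro continuous_intros)
    then show ?thesis unfolding \<gamma>_def
      by (rule continuous_on_compose2[OF chart_continuous_inv[OF ch[OF \<phi>]]]) (use in_img in auto)
  qed
  have "smooth_curve A \<gamma>"
    unfolding smooth_curve_def
  proof (intro conjI ballI cont)
    fix \<psi> assume \<psi>: "\<psi> \<in> A"
    have "smooth_on (coord \<phi> ` (dom_of \<phi> \<inter> dom_of \<psi>)) (transition \<phi> \<psi>)"
      by (rule smooth_structureD(2)[OF A \<phi> \<psi>])
    moreover have "open (\<gamma> -` dom_of \<psi>)" using open_vimage[OF chart_open_dom[OF ch[OF \<psi>]] cont] .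
    moreover have "x + s t *\<^sub>R v \<in> coord \<phi> ` (dom_of \<phi> \<inter> dom_of \<psi>)" if "t \<in> \<gamma> -` dom_of \<psi>" for t
      using that \<gamma>_dom[of t] by (auto simp: \<gamma>_coord[symmetric])
    ultimately have "smooth_on (\<gamma> -` dom_of \<psi>) (\<lambda>t. transition \<phi> \<psi> (x + s t *\<^sub>R v))"
      by (intro smooth_on_compose_curve[OF _ sm_s])
    then show "smooth_on (\<gamma> -` dom_of \<psi>) (coord \<psi> \<circ> \<gamma>)"
      by (simp add: transition_def \<gamma>_def o_def)
  qed
  moreover have "velocity \<phi> \<gamma> 0 = v"
  proof -
    have "((\<lambda>t. x + s t *\<^sub>R v) has_vector_derivative v) (at 0)"
      using s' by (auto intro!: derivative_eq_intros simp: has_real_derivative_iff_has_vector_derivative)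
    then show ?thesis by (simp add: velocity_def o_def \<gamma>_coord vector_derivative_at)
  qed
  moreover have "p \<in> \<Union>F" using F by (simp add: partition_on_def)
  then obtain L where L: "L \<in> F" "p \<in> L" by blast
  have "range \<gamma> \<subseteq> L"
  proof -
    define P where "P = connected_component_set (L \<inter> dom_of \<phi>) p"
    have "p \<in> L \<inter> dom_of \<phi>" using L p by simp
    then have P: "P \<in> components (L \<inter> dom_of \<phi>)" "p \<in> P" "P \<subseteq> L"
      unfolding P_def components_def using connected_component_subset[of "L \<inter> dom_of \<phi>" p] by auto
    then obtain a where a: "P = {q \<in> dom_of \<phi>. coord \<phi> q \<bullet> b = a}" using slices L by blast
    \<comment> \<open>The plaque through \<open>p\<close> is the whole slice, and \<open>\<gamma>\<close> does not change the coordinate along \<open>b\<close>.\<close>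
    have "\<gamma> t \<in> P" for t
      using a P(2) \<gamma>_dom v by (simp add: \<gamma>_coord x_def inner_add_left)
    then show ?thesis using P(3) by auto
  qed
  ultimately show ?thesis using \<gamma>0 L unfolding leaf_tangent_def by blast
qed

section \<open>The covariant derivative of a geodesic unit field\<close>

locale lorentz_geodesic_field =
  fixes A :: "('m::{t2_space, second_countable_topology}, 'e::euclidean_space) chart set"
    and g :: "('m, 'e) metric"
    and nabla :: "('m, 'e) connection"
    and N :: "('m, 'e) vfield"
  assumes smooth_structure: "smooth_structure A"
    and lorentz: "lorentz_metric A g"
    and levi_civita: "levi_civita A g nabla"
    and N_field: "vector_field A N"
    and N_unit: "unit_timelike A g N"
    and N_geodesic: "geodesic_flow A nabla N"
begin

lemmas chart = smooth_structureD(1)[OF smooth_structure]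
  and transition_smooth = smooth_structureD(2)[OF smooth_structure]
  and chart_exists = smooth_structureD(3)[OF smooth_structure]

lemma open_img: "\<phi> \<in> A \<Longrightarrow> open (img_of \<phi>)"
  by (simp add: chart chart_open_img)

lemma coord_in: "\<phi> \<in> A \<Longrightarrow> p \<in> dom_of \<phi> \<Longrightarrow> coord \<phi> p \<in> img_of \<phi>"
  by (simp add: chart chart_coord_in)

lemma transition_has_derivative:
  assumes "\<phi> \<in> A" "\<psi> \<in> A" "p \<in> dom_of \<phi> \<inter> dom_of \<psi>"
  shows "(transition \<phi> \<psi> has_derivative frechet_derivative (transition \<phi> \<psi>) (at (coord \<phi> p)))
    (at (coord \<phi> p))"
  using assms by (intro smooth_on_has_derivative[OF transition_smooth]) auto

lemma N_smooth: "\<phi> \<in> A \<Longrightarrow> smooth_on (img_of \<phi>) (N \<phi>)"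
  using N_field by (simp add: vector_field_def)

lemma N_has_derivative:
  "\<phi> \<in> A \<Longrightarrow> x \<in> img_of \<phi> \<Longrightarrow> (N \<phi> has_derivative frechet_derivative (N \<phi>) (at x)) (at x)"
  using smooth_on_has_derivative[OF N_smooth] by blast

lemma N_transform:
  "\<phi> \<in> A \<Longrightarrow> \<psi> \<in> A \<Longrightarrow> p \<in> dom_of \<phi> \<inter> dom_of \<psi> \<Longrightarrow>
    N \<psi> (coord \<psi> p) = frechet_derivative (transition \<phi> \<psi>) (at (coord \<phi> p)) (N \<phi> (coord \<phi> p))"
  using N_field unfolding vector_field_def by blast

lemma g_N_N: "\<phi> \<in> A \<Longrightarrow> x \<in> img_of \<phi> \<Longrightarrow> g \<phi> x (N \<phi> x) (N \<phi> x) = - 1"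
  using N_unit by (simp add: unit_timelike_def)

lemma g_lorentz_form: "\<phi> \<in> A \<Longrightarrow> x \<in> img_of \<phi> \<Longrightarrow> lorentz_form (g \<phi> x)"
  using lorentz by (simp add: lorentz_metric_def)

lemma g_bilinear: "\<phi> \<in> A \<Longrightarrow> x \<in> img_of \<phi> \<Longrightarrow> bilinear (g \<phi> x)"
  and g_sym: "\<phi> \<in> A \<Longrightarrow> x \<in> img_of \<phi> \<Longrightarrow> g \<phi> x u v = g \<phi> x v u"
  using g_lorentz_form unfolding lorentz_form_def by blast+

lemma g_transform:
  "\<phi> \<in> A \<Longrightarrow> \<psi> \<in> A \<Longrightarrow> p \<in> dom_of \<phi> \<inter> dom_of \<psi> \<Longrightarrow>
    g \<psi> (coord \<psi> p) (frechet_derivative (transition \<phi> \<psi>) (at (coord \<phi> p)) u)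
      (frechet_derivative (transition \<phi> \<psi>) (at (coord \<phi> p)) v) = g \<phi> (coord \<phi> p) u v"
  using lorentz unfolding lorentz_metric_def by metis

lemma Gamma_bilinear: "\<phi> \<in> A \<Longrightarrow> x \<in> img_of \<phi> \<Longrightarrow> bilinear (nabla \<phi> x)"
  using levi_civita by (simp add: levi_civita_def affine_connection_def)

lemma Gamma_has_derivative:
  "\<phi> \<in> A \<Longrightarrow> x \<in> img_of \<phi> \<Longrightarrow>
    ((\<lambda>y. nabla \<phi> y u v) has_derivative frechet_derivative (\<lambda>y. nabla \<phi> y u v) (at x)) (at x)"
  using levi_civita
  by (intro smooth_on_has_derivative) (auto simp: levi_civita_def affine_connection_def)

lemma Gamma_sym:
  assumes "\<phi> \<in> A" "x \<in> img_of \<phi>"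
  shows "nabla \<phi> x u v = nabla \<phi> x v u"
proof -
  have "cov_deriv nabla \<phi> (\<lambda>_. u) (\<lambda>_. v) x - cov_deriv nabla \<phi> (\<lambda>_. v) (\<lambda>_. u) x
      = lie_bracket (\<lambda>_. u) (\<lambda>_. v) x"
  proof -
    have "torsion_free A nabla" using levi_civita by (simp add: levi_civita_def)
    from this[unfolded torsion_free_def, rule_format, OF assms(1), of "\<lambda>_. u" "\<lambda>_. v", OF _ assms(2)]
    show ?thesis by (simp add: smooth_on_const)
  qed
  then show ?thesis by (simp add: cov_deriv_def lie_bracket_def)
qed

lemma Gamma_transform:
  assumes "\<phi> \<in> A" "\<psi> \<in> A" "p \<in> dom_of \<phi> \<inter> dom_of \<psi>"
  defines "D \<equiv> frechet_derivative (transition \<phi> \<psi>) (at (coord \<phi> p))"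
  shows "D (nabla \<phi> (coord \<phi> p) u v) =
    frechet_derivative (\<lambda>y. frechet_derivative (transition \<phi> \<psi>) (at y) v) (at (coord \<phi> p)) u
      + nabla \<psi> (coord \<psi> p) (D u) (D v)"
proof -
  have "\<forall>\<phi>\<in>A. \<forall>\<psi>\<in>A. \<forall>p\<in>dom_of \<phi> \<inter> dom_of \<psi>. \<forall>u v.
      frechet_derivative (transition \<phi> \<psi>) (at (coord \<phi> p)) (nabla \<phi> (coord \<phi> p) u v) =
      frechet_derivative (\<lambda>y. frechet_derivative (transition \<phi> \<psi>) (at y) v) (at (coord \<phi> p)) u
        + nabla \<psi> (coord \<psi> p) (frechet_derivative (transition \<phi> \<psi>) (at (coord \<phi> p)) u)
            (frechet_derivative (transition \<phi> \<psi>) (at (coord \<phi> p)) v)"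
    using levi_civita unfolding levi_civita_def affine_connection_def Let_def by (elim conjE)
  then show ?thesis unfolding D_def using assms(1-3) by blast
qed

text \<open>The endomorphism \<open>v \<mapsto> \<nabla>\<^sub>v N\<close>; on the leaves it is the shape operator, up to sign.\<close>

definition shape :: "('m, 'e) chart \<Rightarrow> 'e \<Rightarrow> 'e \<Rightarrow> 'e" where
  "shape \<phi> x v = frechet_derivative (N \<phi>) (at x) v + nabla \<phi> x v (N \<phi> x)"

lemma shape_linear:
  assumes "\<phi> \<in> A" "x \<in> img_of \<phi>"
  shows "linear (shape \<phi> x)"
proof -
  have "linear (\<lambda>v. frechet_derivative (N \<phi>) (at x) v + nabla \<phi> x v (N \<phi> x))"
    using has_derivative_linear[OF N_has_derivative[OF assms]] Gamma_bilinear[OF assms]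
    by (intro linear_compose_add) (auto simp: bilinear_def)
  then show ?thesis by (simp add: shape_def[abs_def])
qed

lemma shape_N: "\<phi> \<in> A \<Longrightarrow> x \<in> img_of \<phi> \<Longrightarrow> shape \<phi> x (N \<phi> x) = 0"
  using N_geodesic by (simp add: geodesic_flow_def cov_deriv_def shape_def)

lemma metric_compatible:
  assumes "\<phi> \<in> A" "x \<in> img_of \<phi>" "smooth_on (img_of \<phi>) Z"
  shows "frechet_derivative (\<lambda>y. g \<phi> y (N \<phi> y) (Z y)) (at x) v =
    g \<phi> x (shape \<phi> x v) (Z x) + g \<phi> x (N \<phi> x) (cov_deriv nabla \<phi> (\<lambda>_. v) Z x)"
proof -
  have "frechet_derivative (\<lambda>y. g \<phi> y (N \<phi> y) (Z y)) (at x) v =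
    g \<phi> x (cov_deriv nabla \<phi> (\<lambda>_. v) (N \<phi>) x) (Z x) + g \<phi> x (N \<phi> x) (cov_deriv nabla \<phi> (\<lambda>_. v) Z x)"
    using levi_civita assms N_smooth smooth_on_const
    unfolding levi_civita_def metric_connection_def by blast
  then show ?thesis by (simp add: cov_deriv_def shape_def)
qed

text \<open>Differentiate \<open>g(N, N) = - 1\<close>.\<close>

lemma shape_orthogonal:
  assumes "\<phi> \<in> A" "x \<in> img_of \<phi>"
  shows "g \<phi> x (shape \<phi> x v) (N \<phi> x) = 0"
proof -
  have "frechet_derivative (\<lambda>y. g \<phi> y (N \<phi> y) (N \<phi> y)) (at x) v = 0"
    by (rule frechet_derivative_locally_const[OF open_img[OF assms(1)] assms(2)]) (rule g_N_N[OF assms(1)])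
  then have "g \<phi> x (shape \<phi> x v) (N \<phi> x) + g \<phi> x (N \<phi> x) (shape \<phi> x v) = 0"
    using metric_compatible[OF assms N_smooth[OF assms(1)], of v]
    by (simp add: cov_deriv_def shape_def)
  then show ?thesis using g_sym[OF assms] by simp
qed

text \<open>The derivative of \<open>N \<circ> \<tau> = D\<tau> N\<close> produces a second derivative of \<open>\<tau>\<close>, which the transformation law of
the Christoffel maps cancels.\<close>

lemma shape_transform:
  assumes \<phi>: "\<phi> \<in> A" and \<psi>: "\<psi> \<in> A" and p: "p \<in> dom_of \<phi> \<inter> dom_of \<psi>"
  defines "D \<equiv> frechet_derivative (transition \<phi> \<psi>) (at (coord \<phi> p))"
  shows "shape \<psi> (coord \<psi> p) (D u) = D (shape \<phi> (coord \<phi> p) u)"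
proof -
  let ?\<tau> = "transition \<phi> \<psi>" and ?x = "coord \<phi> p" and ?O = "coord \<phi> ` (dom_of \<phi> \<inter> dom_of \<psi>)"
  have O: "open ?O" "?x \<in> ?O" using open_overlap[OF chart[OF \<phi>] chart[OF \<psi>]] p by auto
  have "((\<lambda>y. frechet_derivative ?\<tau> (at y) (N \<phi> y)) has_derivative
      (\<lambda>h. frechet_derivative (\<lambda>y. frechet_derivative ?\<tau> (at y) (N \<phi> ?x)) (at ?x) h
        + D (frechet_derivative (N \<phi>) (at ?x) h))) (at ?x)"
    unfolding D_def
  proof (rule has_derivative_linear_field[where L = "\<lambda>y. frechet_derivative ?\<tau> (at y)"
        and L' = "\<lambda>v. frechet_derivative (\<lambda>y. frechet_derivative ?\<tau> (at y) v) (at ?x)", OF O])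
    show "linear (frechet_derivative ?\<tau> (at y))" if "y \<in> ?O" for y
      using smooth_on_imp_differentiable[OF transition_smooth[OF \<phi> \<psi>] that]
      by (rule linear_frechet_derivative)
    show "((\<lambda>y. frechet_derivative ?\<tau> (at y) v) has_derivative
        frechet_derivative (\<lambda>y. frechet_derivative ?\<tau> (at y) v) (at ?x)) (at ?x)" for v
      by (rule smooth_on_has_derivative[OF smooth_on_frechet_derivative[OF transition_smooth[OF \<phi> \<psi>]] O(2)])
    show "(N \<phi> has_derivative frechet_derivative (N \<phi>) (at ?x)) (at ?x)"
      using p by (intro N_has_derivative[OF \<phi>] coord_in[OF \<phi>]) auto
  qed
  then have 1: "((\<lambda>y. N \<psi> (?\<tau> y)) has_derivative
      (\<lambda>h. frechet_derivative (\<lambda>y. frechet_derivative ?\<tau> (at y) (N \<phi> ?x)) (at ?x) h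
        + D (frechet_derivative (N \<phi>) (at ?x) h))) (at ?x)"
    by (rule has_derivative_transform_within_open[OF _ O])
      (auto simp: N_transform[OF \<phi> \<psi>] transition_coord[OF chart[OF \<phi>]])
  have tx: "?\<tau> ?x = coord \<psi> p" using p by (simp add: transition_coord[OF chart[OF \<phi>]])
  have N\<psi>: "(N \<psi> has_derivative frechet_derivative (N \<psi>) (at (coord \<psi> p))) (at (?\<tau> ?x))"
    unfolding tx using p by (intro N_has_derivative[OF \<psi>] coord_in[OF \<psi>]) auto
  have 2: "((\<lambda>y. N \<psi> (?\<tau> y)) has_derivative (\<lambda>h. frechet_derivative (N \<psi>) (at (coord \<psi> p)) (D h))) (at ?x)"
    unfolding D_def by (rule has_derivative_compose[OF transition_has_derivative[OF \<phi> \<psi> p] N\<psi>])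
  have eq: "frechet_derivative (N \<psi>) (at (coord \<psi> p)) (D u) =
      frechet_derivative (\<lambda>y. frechet_derivative ?\<tau> (at y) (N \<phi> ?x)) (at ?x) u
        + D (frechet_derivative (N \<phi>) (at ?x) u)"
    using fun_cong[OF has_derivative_unique[OF 1 2], of u] by simp
  have "D (shape \<phi> ?x u) = D (frechet_derivative (N \<phi>) (at ?x) u) + D (nabla \<phi> ?x u (N \<phi> ?x))"
    unfolding shape_def D_def
    by (rule linear_add[OF has_derivative_linear[OF transition_has_derivative[OF \<phi> \<psi> p]]])
  then show ?thesis
    using eq Gamma_transform[OF \<phi> \<psi> p, of u "N \<phi> ?x"] N_transform[OF \<phi> \<psi> p]
    by (simp add: shape_def D_def)
qed

text \<open>The divergence of \<open>N\<close>.\<close>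

definition expansion :: "('m, 'e) chart \<Rightarrow> 'e \<Rightarrow> real" where
  "expansion \<phi> x = endo_trace (shape \<phi> x)"

lemma shape_has_derivative:
  assumes \<phi>: "\<phi> \<in> A" and x: "x \<in> img_of \<phi>"
  shows "((\<lambda>y. shape \<phi> y b) has_derivative
    (\<lambda>h. frechet_derivative (\<lambda>y. frechet_derivative (N \<phi>) (at y) b) (at x) h
      + (frechet_derivative (\<lambda>y. nabla \<phi> y b (N \<phi> x)) (at x) h
        + nabla \<phi> x b (frechet_derivative (N \<phi>) (at x) h)))) (at x)"
proof -
  have 1: "((\<lambda>y. frechet_derivative (N \<phi>) (at y) b) has_derivative
      frechet_derivative (\<lambda>y. frechet_derivative (N \<phi>) (at y) b) (at x)) (at x)"
    by (rule smooth_on_has_derivative[OF smooth_on_frechet_derivative[OF N_smooth[OF \<phi>]] x])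
  have 2: "((\<lambda>y. nabla \<phi> y b (N \<phi> y)) has_derivative
      (\<lambda>h. frechet_derivative (\<lambda>y. nabla \<phi> y b (N \<phi> x)) (at x) h
        + nabla \<phi> x b (frechet_derivative (N \<phi>) (at x) h))) (at x)"
    using Gamma_bilinear[OF \<phi>]
    by (intro has_derivative_linear_field[OF open_img[OF \<phi>] x _ Gamma_has_derivative[OF \<phi> x] N_has_derivative[OF \<phi> x]])
      (auto simp: bilinear_def)
  show ?thesis unfolding shape_def by (rule has_derivative_add[OF 1 2])
qed

text \<open>Write \<open>\<partial>\<close> for the coordinate derivative and \<open>S v = \<partial>\<^sub>v N + \<Gamma>(v, N)\<close>. Differentiating the geodesic
equation \<open>\<partial>\<^sub>N N + \<Gamma>(N, N) = 0\<close> in the direction \<open>b\<close> expresses the second derivative of \<open>N\<close> that occurs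
in \<open>\<partial>\<^sub>N (S b)\<close> by first derivatives. What results is \<open>- R(b, N) N - S (S b)\<close> plus the commutator of the
endomorphisms \<open>v \<mapsto> \<partial>\<^sub>v N\<close> and \<open>v \<mapsto> \<Gamma>(v, N)\<close>. The commutator reflects that the standard basis is not
parallel along \<open>N\<close>, and it has trace \<open>0\<close>.\<close>

lemma raychaudhuri:
  assumes \<phi>: "\<phi> \<in> A" and x: "x \<in> img_of \<phi>"
  obtains E where "(expansion \<phi> has_derivative E) (at x)"
    and "E (N \<phi> x) =
      - endo_trace (\<lambda>b. curvature nabla \<phi> (\<lambda>_. b) (\<lambda>_. N \<phi> x) (\<lambda>_. N \<phi> x) x)
      - endo_trace (\<lambda>b. shape \<phi> x (shape \<phi> x b))"
proof -
  define n where "n = N \<phi> x"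
  define G where "G = nabla \<phi> x"
  define DN where "DN = frechet_derivative (N \<phi>) (at x)"
  define DDN where "DDN u h = frechet_derivative (\<lambda>y. frechet_derivative (N \<phi>) (at y) u) (at x) h" for u h
  define DG where "DG u v h = frechet_derivative (\<lambda>y. nabla \<phi> y u v) (at x) h" for u v h
  have G: "bilinear G" and G_sym: "G u v = G v u" for u v
    using Gamma_bilinear[OF \<phi> x] Gamma_sym[OF \<phi> x] by (auto simp: G_def)
  have DN: "linear DN" unfolding DN_def by (rule has_derivative_linear[OF N_has_derivative[OF \<phi> x]])
  have shape: "shape \<phi> x v = DN v + G v n" for v by (simp add: shape_def DN_def G_def n_def)
  have geod: "DN n + G n n = 0" using shape_N[OF \<phi> x] shape by (simp add: n_def)

  have nabla_N: "((\<lambda>y. frechet_derivative (N \<phi>) (at y) (N \<phi> y) + nabla \<phi> y (N \<phi> y) (N \<phi> y)) has_derivative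
      (\<lambda>h. (DDN n h + DN (DN h)) + (DG n n h + G n (DN h) + G (DN h) n))) (at x)"
    unfolding DDN_def DN_def DG_def G_def n_def
  proof (intro has_derivative_add)
    show "((\<lambda>y. frechet_derivative (N \<phi>) (at y) (N \<phi> y)) has_derivative
        (\<lambda>h. frechet_derivative (\<lambda>y. frechet_derivative (N \<phi>) (at y) (N \<phi> x)) (at x) h
          + frechet_derivative (N \<phi>) (at x) (frechet_derivative (N \<phi>) (at x) h))) (at x)"
      by (rule has_derivative_linear_field[OF open_img[OF \<phi>] x
            has_derivative_linear[OF N_has_derivative[OF \<phi>]]
            smooth_on_has_derivative[OF smooth_on_frechet_derivative[OF N_smooth[OF \<phi>]] x]
            N_has_derivative[OF \<phi> x]])
    show "((\<lambda>y. nabla \<phi> y (N \<phi> y) (N \<phi> y)) has_derivative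
        (\<lambda>h. frechet_derivative (\<lambda>y. nabla \<phi> y (N \<phi> x) (N \<phi> x)) (at x) h
          + nabla \<phi> x (N \<phi> x) (frechet_derivative (N \<phi>) (at x) h)
          + nabla \<phi> x (frechet_derivative (N \<phi>) (at x) h) (N \<phi> x))) (at x)"
      by (rule has_derivative_bilinear_field[OF open_img[OF \<phi>] x Gamma_bilinear[OF \<phi>]
            Gamma_has_derivative[OF \<phi> x] N_has_derivative[OF \<phi> x] N_has_derivative[OF \<phi> x]])
  qed
  have nabla_N_0: "((\<lambda>y. frechet_derivative (N \<phi>) (at y) (N \<phi> y) + nabla \<phi> y (N \<phi> y) (N \<phi> y))
      has_derivative (\<lambda>_. 0)) (at x)"
    by (rule has_derivative_transform_within_open[OF has_derivative_const[of 0] open_img[OF \<phi>] x])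
      (use shape_N[OF \<phi>] in \<open>simp add: shape_def\<close>)
  have geod': "(DDN n h + DN (DN h)) + (DG n n h + G n (DN h) + G (DN h) n) = 0" for h
    by (rule fun_cong[OF has_derivative_unique[OF nabla_N nabla_N_0]])

  define E' where "E' b h = DDN b h + (DG b n h + G b (DN h))" for b h
  have E': "((\<lambda>y. shape \<phi> y b) has_derivative E' b) (at x)" for b
    using shape_has_derivative[OF \<phi> x, of b]
    by (simp add: E'_def[abs_def] DDN_def DG_def G_def DN_def n_def)
  define R where "R b = curvature nabla \<phi> (\<lambda>_. b) (\<lambda>_. n) (\<lambda>_. n) x" for b
  have E'_n: "E' b n = (DN (G b n) - G (DN b) n) - R b - shape \<phi> x (shape \<phi> x b)" for b
  proof -
    have R: "R b = DG n n b + G b (G n n) - DG b n n - G n (G b n)"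
      unfolding R_def DG_def G_def by (rule curvature_const_fields[where \<Gamma> = nabla and \<phi> = \<phi> and x = x, OF Gamma_bilinear[OF \<phi> x]])
    have "DDN b n = DDN n b"
      unfolding DDN_def by (rule second_derivative_symmetric[OF open_img[OF \<phi>] x N_smooth[OF \<phi>]])
    also have "\<dots> = - DN (DN b) - DG n n b - G n (DN b) - G (DN b) n"
      using geod'[of b] by (simp add: algebra_simps eq_neg_iff_add_eq_0)
    finally have DDN: "DDN b n = - DN (DN b) - DG n n b - G n (DN b) - G (DN b) n" .
    have "DN n = - G n n" using geod by (simp add: eq_neg_iff_add_eq_0)
    then show ?thesis
      unfolding E'_def R shape
      by (simp add: DDN linear_add[OF DN] bilinear_ladd[OF G] bilinear_rneg[OF G] G_sym[of "DN b" n]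
          G_sym[of n "G b n"])
  qed
  show ?thesis
  proof
    show "(expansion \<phi> has_derivative (\<lambda>h. \<Sum>b\<in>Basis. E' b h \<bullet> b)) (at x)"
      unfolding expansion_def[abs_def] endo_trace_def
      by (intro has_derivative_sum has_derivative_inner_left E')
    have "linear (\<lambda>v. G v n)" using G by (simp add: bilinear_def)
    then have "endo_trace (\<lambda>b. DN (G b n)) = endo_trace (\<lambda>b. G (DN b) n)"
      by (rule trace_mult_commute[OF DN])
    then show "(\<Sum>b\<in>Basis. E' b (N \<phi> x) \<bullet> b) =
      - endo_trace (\<lambda>b. curvature nabla \<phi> (\<lambda>_. b) (\<lambda>_. N \<phi> x) (\<lambda>_. N \<phi> x) x)
      - endo_trace (\<lambda>b. shape \<phi> x (shape \<phi> x b))"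
      unfolding n_def[symmetric] E'_n R_def[symmetric]
      by (simp add: endo_trace_def inner_diff_left sum_subtractf)
  qed
qed

lemma expansion_in_frame:
  assumes \<phi>: "\<phi> \<in> A" and x: "x \<in> img_of \<phi>" and frame: "lorentz_frame (g \<phi> x) n e (N \<phi> x)"
  shows "expansion \<phi> x = (\<Sum>i=1..n. g \<phi> x (shape \<phi> x (e i)) (e i))"
  using lorentz_frame.trace_eq[OF frame shape_linear[OF \<phi> x]] shape_orthogonal[OF \<phi> x]
  by (simp add: expansion_def)

lemma lorentz_frame_transform:
  assumes \<phi>: "\<phi> \<in> A" and \<psi>: "\<psi> \<in> A" and p: "p \<in> dom_of \<phi> \<inter> dom_of \<psi>"
    and frame: "lorentz_frame (g \<phi> (coord \<phi> p)) n e (N \<phi> (coord \<phi> p))"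
  defines "D \<equiv> frechet_derivative (transition \<phi> \<psi>) (at (coord \<phi> p))"
  shows "lorentz_frame (g \<psi> (coord \<psi> p)) n (\<lambda>i. D (e i)) (N \<psi> (coord \<psi> p))"
proof -
  have x: "coord \<psi> p \<in> img_of \<psi>" using p coord_in[OF \<psi>] by simp
  show ?thesis
    unfolding lorentz_frame_def N_transform[OF \<phi> \<psi> p] D_def g_transform[OF \<phi> \<psi> p]
    using frame g_bilinear[OF \<psi> x] g_sym[OF \<psi> x] by (auto simp: lorentz_frame_def)
qed

text \<open>The transition map carries \<open>N\<close>, an orthonormal frame and the shape operator in one chart to those in
the other, so the frame expressions of the two traces agree term by term.\<close>

lemma expansion_invariant:
  assumes \<phi>: "\<phi> \<in> A" and \<psi>: "\<psi> \<in> A" and p: "p \<in> dom_of \<phi> \<inter> dom_of \<psi>"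
    and frame: "lorentz_frame (g \<phi> (coord \<phi> p)) n e (N \<phi> (coord \<phi> p))"
  shows "expansion \<psi> (coord \<psi> p) = expansion \<phi> (coord \<phi> p)"
  using p coord_in[OF \<phi>] coord_in[OF \<psi>]
  by (simp add: expansion_in_frame[OF \<phi> _ frame] shape_transform[OF \<phi> \<psi> p] g_transform[OF \<phi> \<psi> p]
      expansion_in_frame[OF \<psi> _ lorentz_frame_transform[OF \<phi> \<psi> p frame]])

section \<open>Geodesics that start tangent to the field\<close>

lemma velocity_transform:
  assumes \<phi>: "\<phi> \<in> A" and \<psi>: "\<psi> \<in> A" and t: "\<gamma> t \<in> dom_of \<phi> \<inter> dom_of \<psi>" and \<gamma>: "smooth_curve A \<gamma>"
  shows "velocity \<psi> \<gamma> t =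
    frechet_derivative (transition \<phi> \<psi>) (at (coord \<phi> (\<gamma> t))) (velocity \<phi> \<gamma> t)"
proof -
  let ?D = "frechet_derivative (transition \<phi> \<psi>) (at (coord \<phi> (\<gamma> t)))"
  have "((\<lambda>s. coord \<phi> (\<gamma> s)) has_derivative (\<lambda>h. h *\<^sub>R velocity \<phi> \<gamma> t)) (at t)"
    using smooth_curve_has_velocity[OF \<phi> \<gamma>] t by (simp add: has_vector_derivative_def)
  from has_derivative_compose[OF this transition_has_derivative[OF \<phi> \<psi> t]]
  have "((\<lambda>s. transition \<phi> \<psi> (coord \<phi> (\<gamma> s))) has_vector_derivative ?D (velocity \<phi> \<gamma> t)) (at t)"
    by (simp add: has_vector_derivative_def
        linear_scale[OF has_derivative_linear[OF transition_has_derivative[OF \<phi> \<psi> t]]])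
  then have "((\<lambda>s. coord \<psi> (\<gamma> s)) has_vector_derivative ?D (velocity \<phi> \<gamma> t)) (at t)"
    by (rule has_vector_derivative_transform_within_open[OF _ smooth_curve_open_preimage[OF chart[OF \<phi>] \<gamma>]])
      (use t transition_coord[OF chart[OF \<phi>]] in auto)
  then show ?thesis by (simp add: velocity_def o_def vector_derivative_at)
qed

text \<open>The vector field along \<open>\<gamma>\<close> that vanishes exactly where \<open>\<gamma>\<close> has the velocity of an integral curve of \<open>N\<close>.\<close>

definition velocity_defect :: "(real \<Rightarrow> 'm) \<Rightarrow> ('m, 'e) chart \<Rightarrow> real \<Rightarrow> 'e" where
  "velocity_defect \<gamma> \<phi> t = velocity \<phi> \<gamma> t - N \<phi> (coord \<phi> (\<gamma> t))"

lemma velocity_defect_has_derivative: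
  assumes \<phi>: "\<phi> \<in> A" and t: "\<gamma> t \<in> dom_of \<phi>" and \<gamma>: "smooth_curve A \<gamma>"
  shows "(velocity_defect \<gamma> \<phi> has_vector_derivative (vector_derivative (velocity \<phi> \<gamma>) (at t)
    - frechet_derivative (N \<phi>) (at (coord \<phi> (\<gamma> t))) (velocity \<phi> \<gamma> t))) (at t)"
  unfolding velocity_defect_def[abs_def]
proof (rule has_vector_derivative_diff[OF smooth_curve_has_acceleration[OF chart[OF \<phi>] \<phi> \<gamma> t]])
  have c: "((\<lambda>s. coord \<phi> (\<gamma> s)) has_derivative (\<lambda>h. h *\<^sub>R velocity \<phi> \<gamma> t)) (at t)"
    using smooth_curve_has_velocity[OF \<phi> \<gamma> t] by (simp add: has_vector_derivative_def)
  note N' = N_has_derivative[OF \<phi> coord_in[OF \<phi> t]]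
  from has_derivative_compose[OF c N']
  show "((\<lambda>s. N \<phi> (coord \<phi> (\<gamma> s))) has_vector_derivative
      frechet_derivative (N \<phi>) (at (coord \<phi> (\<gamma> t))) (velocity \<phi> \<gamma> t)) (at t)"
    by (simp add: has_vector_derivative_def linear_scale[OF has_derivative_linear[OF N']])
qed

text \<open>Along a geodesic \<open>\<gamma>\<close> the defect \<open>w = \<gamma>' - N\<close> has the covariant derivative
\<open>- \<nabla>\<^bsub>\<gamma>'\<^esub> N = - S (w + N) = - S w\<close>. So \<open>w\<close> solves a homogeneous linear equation with continuous
coefficients, and a zero propagates to a neighbourhood.\<close>

lemma velocity_defect_locally_zero:
  assumes \<phi>: "\<phi> \<in> A" and t0: "\<gamma> t0 \<in> dom_of \<phi>" and \<gamma>: "geodesic A nabla \<gamma>"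
    and zero: "velocity_defect \<gamma> \<phi> t0 = 0"
  shows "\<exists>r>0. \<forall>t\<in>ball t0 r. \<gamma> t \<in> dom_of \<phi> \<and> velocity_defect \<gamma> \<phi> t = 0"
proof -
  let ?U = "\<gamma> -` dom_of \<phi>" and ?w = "velocity_defect \<gamma> \<phi>"
  define x where "x t = coord \<phi> (\<gamma> t)" for t
  define x' where "x' = velocity \<phi> \<gamma>"
  have sm: "smooth_curve A \<gamma>" using \<gamma> by (simp add: geodesic_def)
  have U: "open ?U" "t0 \<in> ?U" using smooth_curve_open_preimage[OF chart[OF \<phi>] sm] t0 by auto
  have x_img: "x t \<in> img_of \<phi>" if "t \<in> ?U" for t using coord_in[OF \<phi>] that by (simp add: x_def)
  define M where "M t v = nabla \<phi> (x t) (x' t) v + shape \<phi> (x t) v" for t v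
  have M_lin: "linear (M t)" if "t \<in> ?U" for t
    unfolding M_def[abs_def] using Gamma_bilinear[OF \<phi> x_img[OF that]]
    by (intro linear_compose_add shape_linear[OF \<phi> x_img[OF that]]) (simp add: bilinear_def)
  have w': "(?w has_vector_derivative - M t (?w t)) (at t)" if t: "t \<in> ?U" for t
  proof -
    have "vector_derivative x' (at t) + nabla \<phi> (x t) (x' t) (x' t) = 0"
      using \<gamma> \<phi> t by (simp add: geodesic_def x_def x'_def)
    moreover have "shape \<phi> (x t) (?w t) = shape \<phi> (x t) (x' t)"
      using linear_diff[OF shape_linear[OF \<phi> x_img[OF t]]] shape_N[OF \<phi> x_img[OF t]]
      by (simp add: velocity_defect_def x_def x'_def)
    moreover have "nabla \<phi> (x t) (x' t) (?w t) =
        nabla \<phi> (x t) (x' t) (x' t) - nabla \<phi> (x t) (x' t) (N \<phi> (x t))"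
      unfolding velocity_defect_def x'_def x_def
      by (rule bilinear_rsub[OF Gamma_bilinear[OF \<phi> x_img[OF t, unfolded x_def]]])
    ultimately have "vector_derivative x' (at t) - frechet_derivative (N \<phi>) (at (x t)) (x' t) = - M t (?w t)"
      by (simp add: M_def shape_def eq_neg_iff_add_eq_0 algebra_simps)
    then show ?thesis
      using velocity_defect_has_derivative[OF \<phi> _ sm, of t] t by (simp add: x_def x'_def)
  qed
  have x_der: "(x has_derivative (\<lambda>h. h *\<^sub>R x' t0)) (at t0)"
    using smooth_curve_has_velocity[OF \<phi> sm t0] by (simp add: has_vector_derivative_def x_def[abs_def] x'_def)
  have "isCont (\<lambda>t. M t b) t0" for b
  proof -
    have "((\<lambda>t. nabla \<phi> (x t) u v) has_derivative
        (\<lambda>h. frechet_derivative (\<lambda>y. nabla \<phi> y u v) (at (x t0)) (h *\<^sub>R x' t0))) (at t0)" for u v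
      by (rule has_derivative_compose[OF x_der Gamma_has_derivative[OF \<phi> x_img[OF U(2)]]])
    from has_derivative_bilinear_field[OF U Gamma_bilinear[OF \<phi> x_img] this
        smooth_curve_has_acceleration[OF chart[OF \<phi>] \<phi> sm t0, folded x'_def, unfolded has_vector_derivative_def]
        has_derivative_const[of b]]
    have "isCont (\<lambda>t. nabla \<phi> (x t) (x' t) b) t0"
      by (rule has_derivative_continuous)
    moreover have "isCont (\<lambda>t. shape \<phi> (x t) b) t0"
      using has_derivative_continuous[OF x_der]
        has_derivative_continuous[OF shape_has_derivative[OF \<phi> x_img[OF U(2)]]]
      by (rule isCont_o2)
    ultimately show ?thesis unfolding M_def by (rule continuous_add)
  qed
  then have K: "isCont (\<lambda>t. \<Sum>b\<in>Basis. norm (M t b)) t0" (is "isCont ?K t0")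
    by (intro continuous_intros)
  have M_bound: "norm (M t v) \<le> ?K t * norm v" if t: "t \<in> ?U" for t v
  proof -
    have "M t v = (\<Sum>b\<in>Basis. (v \<bullet> b) *\<^sub>R M t b)"
    proof -
      have "M t (\<Sum>b\<in>Basis. (v \<bullet> b) *\<^sub>R b) = (\<Sum>b\<in>Basis. (v \<bullet> b) *\<^sub>R M t b)"
        by (simp only: linear_sum[OF M_lin[OF t]] linear_scale[OF M_lin[OF t]])
      then show ?thesis by (simp add: euclidean_representation)
    qed
    also have "norm \<dots> \<le> (\<Sum>b\<in>Basis. norm (M t b) * norm v)"
      by (rule sum_norm_le) (simp add: Basis_le_norm mult_left_mono mult.commute[of _ "norm (M t _)"])
    finally show ?thesis by (simp add: sum_distrib_right)
  qed
  obtain r1 where r1: "r1 > 0" "ball t0 r1 \<subseteq> ?U" using U open_contains_ball by blast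
  obtain r2 where r2: "r2 > 0" "\<And>t. dist t t0 < r2 \<Longrightarrow> dist (?K t) (?K t0) < 1"
    using K[unfolded continuous_at_eps_delta, rule_format, of 1] by auto
  have sub: "t \<in> ?U \<and> ?K t \<le> ?K t0 + 1" if "t \<in> ball t0 (min r1 r2)" for t
  proof -
    have "dist (?K t) (?K t0) < 1" using r2(2)[of t] that by (simp add: dist_commute)
    moreover have "t \<in> ball t0 r1" using that by simp
    ultimately show ?thesis using r1(2) by (auto simp: dist_real_def)
  qed
  have "?w t = 0" if "t \<in> ball t0 (min r1 r2)" for t
  proof (rule linear_growth_zero[of t0 "min r1 r2" ?w "\<lambda>t. - M t (?w t)" "?K t0 + 1", OF _ _ zero that])
    fix t assume t: "t \<in> ball t0 (min r1 r2)"
    show "(?w has_vector_derivative - M t (?w t)) (at t)" using w' sub[OF t] by blast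
    have "norm (M t (?w t)) \<le> ?K t * norm (?w t)" using M_bound sub[OF t] by blast
    also have "\<dots> \<le> (?K t0 + 1) * norm (?w t)" using sub[OF t] by (intro mult_right_mono) auto
    finally show "norm (- M t (?w t)) \<le> (?K t0 + 1) * norm (?w t)" by simp
  qed
  then show ?thesis using sub r1(1) r2(1) by (intro exI[of _ "min r1 r2"]) auto
qed

lemma velocity_defect_invariant:
  assumes \<phi>: "\<phi> \<in> A" and \<psi>: "\<psi> \<in> A" and t: "\<gamma> t \<in> dom_of \<phi>" "\<gamma> t \<in> dom_of \<psi>"
    and \<gamma>: "smooth_curve A \<gamma>" and zero: "velocity_defect \<gamma> \<phi> t = 0"
  shows "velocity_defect \<gamma> \<psi> t = 0"
  using zero velocity_transform[OF \<phi> \<psi> _ \<gamma>, of t] N_transform[OF \<phi> \<psi>, of "\<gamma> t"] t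
  by (simp add: velocity_defect_def)

text \<open>The times at which the defect vanishes form an open set by local uniqueness, and so do the others by
continuity; whether it vanishes does not depend on the chart. Since the real line is connected, the
defect vanishes at all times.\<close>

lemma geodesic_is_integral_curve:
  assumes \<gamma>: "geodesic A nabla \<gamma>" and \<phi>0: "\<phi>0 \<in> A" "\<gamma> 0 \<in> dom_of \<phi>0"
    and init: "velocity \<phi>0 \<gamma> 0 = N \<phi>0 (coord \<phi>0 (\<gamma> 0))"
    and \<phi>: "\<phi> \<in> A" "\<gamma> t \<in> dom_of \<phi>"
  shows "velocity \<phi> \<gamma> t = N \<phi> (coord \<phi> (\<gamma> t))"
proof -
  have sm: "smooth_curve A \<gamma>" using \<gamma> by (simp add: geodesic_def)
  define Z where "Z = {t. \<exists>\<phi>\<in>A. \<gamma> t \<in> dom_of \<phi> \<and> velocity_defect \<gamma> \<phi> t = 0}"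
  define W where "W = {t. \<exists>\<phi>\<in>A. \<gamma> t \<in> dom_of \<phi> \<and> velocity_defect \<gamma> \<phi> t \<noteq> 0}"
  have "open Z"
    unfolding open_contains_ball
  proof
    fix t assume "t \<in> Z"
    then obtain \<phi> where "\<phi> \<in> A" "\<gamma> t \<in> dom_of \<phi>" "velocity_defect \<gamma> \<phi> t = 0"
      by (auto simp: Z_def)
    then show "\<exists>r>0. ball t r \<subseteq> Z"
      using velocity_defect_locally_zero[OF _ _ \<gamma>, of \<phi> t] unfolding Z_def by blast
  qed
  moreover have "open W"
    unfolding open_contains_ball
  proof
    fix t assume "t \<in> W"
    then obtain \<phi> where \<phi>: "\<phi> \<in> A" "\<gamma> t \<in> dom_of \<phi>" "velocity_defect \<gamma> \<phi> t \<noteq> 0"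
      by (auto simp: W_def)
    have "isCont (velocity_defect \<gamma> \<phi>) t"
      using velocity_defect_has_derivative[OF \<phi>(1,2) sm] by (rule has_vector_derivative_continuous)
    then have "eventually (\<lambda>s. velocity_defect \<gamma> \<phi> s \<noteq> 0) (at t)"
      using \<phi>(3) by (simp add: isCont_def tendsto_imp_eventually_ne)
    moreover have "eventually (\<lambda>s. s \<in> \<gamma> -` dom_of \<phi>) (at t)"
      using smooth_curve_open_preimage[OF chart[OF \<phi>(1)] sm] \<phi>(2) by (intro eventually_at_in_open') auto
    ultimately have "eventually (\<lambda>s. s \<in> W) (at t)"
      by eventually_elim (use \<phi>(1) in \<open>auto simp: W_def\<close>)
    then have "eventually (\<lambda>s. s \<in> W) (nhds t)"
      using \<open>t \<in> W\<close> by (simp add: eventually_nhds_conv_at)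
    then obtain r where "r > 0" "\<And>s. dist s t < r \<Longrightarrow> s \<in> W"
      unfolding eventually_nhds_metric by blast
    then show "\<exists>r>0. ball t r \<subseteq> W"
      by (intro exI[of _ r]) (auto simp: dist_commute)
  qed
  moreover have "Z \<inter> W \<inter> UNIV = {}"
  proof -
    have False if t: "t \<in> Z" "t \<in> W" for t
    proof -
      obtain \<phi> \<psi> where "\<phi> \<in> A" "\<gamma> t \<in> dom_of \<phi>" "velocity_defect \<gamma> \<phi> t = 0"
          "\<psi> \<in> A" "\<gamma> t \<in> dom_of \<psi>" "velocity_defect \<gamma> \<psi> t \<noteq> 0"
        using t unfolding Z_def W_def by blast
      then show False using velocity_defect_invariant[of \<phi> \<psi> \<gamma> t, OF _ _ _ _ sm] by simp
    qed
    then show ?thesis by blast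
  qed
  moreover have "UNIV \<subseteq> Z \<union> W"
  proof
    fix t
    obtain \<phi> where "\<phi> \<in> A" "\<gamma> t \<in> dom_of \<phi>" using chart_exists by blast
    then show "t \<in> Z \<union> W" unfolding Z_def W_def by blast
  qed
  ultimately have "Z \<inter> UNIV = {} \<or> W \<inter> UNIV = {}" by (rule connectedD[OF connected_UNIV])
  moreover have "0 \<in> Z" using \<phi>0 init by (auto simp: Z_def velocity_defect_def)
  ultimately have "t \<notin> W" by auto
  then show ?thesis using \<phi> by (auto simp: W_def velocity_defect_def)
qed

end

section \<open>Mean curvature of the orthogonal foliation\<close>

locale lorentz_geodesic_foliation = lorentz_geodesic_field A g nabla N
  for A :: "('m::{t2_space, second_countable_topology}, 'e::euclidean_space) chart set"
    and g :: "('m, 'e) metric" and nabla :: "('m, 'e) connection" and N :: "('m, 'e) vfield" +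
  fixes F :: "'m set set" and n :: nat and c :: real
  assumes n_pos: "n \<ge> 1" and dim: "DIM('e) = n + 1"
    and foliation: "spacelike_foliation A g F"
    and N_normal: "normal_to_leaves A g F N"
    and const_curv: "constant_sectional_curvature A g nabla c"
begin

text \<open>In a foliation chart the hyperplane orthogonal to the distinguished coordinate consists of vectors
tangent to the leaves, at every point of the chart.\<close>

lemma foliated_chart:
  obtains \<phi> b where "\<phi> \<in> A" "p \<in> dom_of \<phi>" "b \<in> Basis"
    and "\<And>q v. q \<in> dom_of \<phi> \<Longrightarrow> v \<bullet> b = 0 \<Longrightarrow> v \<in> leaf_tangent A F \<phi> q"
proof -
  have fol: "foliation_codim1 A F" using foliation by (simp add: spacelike_foliation_def)
  then obtain \<phi> where \<phi>: "\<phi> \<in> A" "p \<in> dom_of \<phi>" "foliation_chart F \<phi>"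
    unfolding foliation_codim1_def by blast
  then obtain b where b: "b \<in> Basis"
    "\<forall>L\<in>F. \<forall>P\<in>components (L \<inter> dom_of \<phi>). \<exists>a. P = {q \<in> dom_of \<phi>. coord \<phi> q \<bullet> b = a}"
    unfolding foliation_chart_def by blast
  have "partition_on UNIV F" using fol by (simp add: foliation_codim1_def)
  then show ?thesis
    using that[OF \<phi>(1,2) b(1)] slice_subset_leaf_tangent[OF smooth_structure _ \<phi>(1) _ _ b(2)] by blast
qed

lemma leaf_frame_imp_lorentz_frame:
  assumes \<phi>: "\<phi> \<in> A" and p: "p \<in> dom_of \<phi>" and e: "leaf_frame A g F n \<phi> p e"
  shows "lorentz_frame (g \<phi> (coord \<phi> p)) n e (N \<phi> (coord \<phi> p))"
proof
  note x = coord_in[OF \<phi> p]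
  show "DIM('e) = n + 1" by (rule dim)
  show "bilinear (g \<phi> (coord \<phi> p))" by (rule g_bilinear[OF \<phi> x])
  show "g \<phi> (coord \<phi> p) u v = g \<phi> (coord \<phi> p) v u" for u v by (rule g_sym[OF \<phi> x])
  show "g \<phi> (coord \<phi> p) (N \<phi> (coord \<phi> p)) (N \<phi> (coord \<phi> p)) = - 1" by (rule g_N_N[OF \<phi> x])
  show "g \<phi> (coord \<phi> p) (e i) (e j) = (if i = j then 1 else 0)" if "i \<in> {1..n}" "j \<in> {1..n}" for i j
    using e that by (simp add: leaf_frame_def)
  show "g \<phi> (coord \<phi> p) (N \<phi> (coord \<phi> p)) (e i) = 0" if "i \<in> {1..n}" for i
    using e that N_normal \<phi> p unfolding leaf_frame_def normal_to_leaves_def by blast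
qed

text \<open>In a foliation chart constant fields \<open>u\<close>, \<open>v\<close> along the slices are tangent to the leaves at all points.
Differentiating \<open>g(N, u) = 0\<close> in the direction \<open>v\<close> gives \<open>g(S v, u) = - g(N, \<Gamma>(v, u))\<close>, which is
symmetric in \<open>u\<close> and \<open>v\<close> because the connection has no torsion. This is where the integrability of
the complement of \<open>N\<close> enters.\<close>

lemma adapted_frame:
  "\<exists>\<phi>\<in>A. \<exists>e. p \<in> dom_of \<phi> \<and> leaf_frame A g F n \<phi> p e \<and>
    (\<forall>i\<in>{1..n}. \<forall>j\<in>{1..n}. g \<phi> (coord \<phi> p) (shape \<phi> (coord \<phi> p) (e i)) (e j) =
      g \<phi> (coord \<phi> p) (shape \<phi> (coord \<phi> p) (e j)) (e i))"
proof -
  obtain \<phi> b where \<phi>: "\<phi> \<in> A" "p \<in> dom_of \<phi>" and b: "b \<in> Basis"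
    and slice: "\<And>q v. q \<in> dom_of \<phi> \<Longrightarrow> v \<bullet> b = 0 \<Longrightarrow> v \<in> leaf_tangent A F \<phi> q"
    using foliated_chart by blast
  define x where "x = coord \<phi> p"
  note x = coord_in[OF \<phi>, folded x_def]
  define V where "V = {v. b \<bullet> v = 0}"
  have "b \<noteq> 0" using b by auto
  have V: "subspace V" "dim V = n"
    unfolding V_def using subspace_hyperplane dim_hyperplane[OF \<open>b \<noteq> 0\<close>] dim by auto
  have pos: "g \<phi> x v v > 0" if "v \<in> V" "v \<noteq> 0" for v
    using slice[OF \<phi>(2)] that foliation \<phi>
    by (auto simp: spacelike_foliation_def V_def x_def inner_commute)
  have normal: "g \<phi> y (N \<phi> y) u = 0" if "y \<in> img_of \<phi>" "u \<in> V" for y u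
  proof -
    have "inv_coord \<phi> y \<in> dom_of \<phi>" "coord \<phi> (inv_coord \<phi> y) = y"
      using chart_inv_in[OF chart[OF \<phi>(1)]] chart_coord_inv[OF chart[OF \<phi>(1)]] that by auto
    then show ?thesis
      using N_normal \<phi>(1) slice[of "inv_coord \<phi> y" u] that(2)
      unfolding normal_to_leaves_def V_def by (metis (mono_tags, lifting) inner_commute mem_Collect_eq)
  qed
  have shape_eq: "g \<phi> x (shape \<phi> x v) u = - g \<phi> x (N \<phi> x) (nabla \<phi> x v u)" if u: "u \<in> V" for u v
  proof -
    have "frechet_derivative (\<lambda>y. g \<phi> y (N \<phi> y) u) (at x) v = 0"
      by (rule frechet_derivative_locally_const[OF open_img[OF \<phi>(1)] x]) (rule normal[OF _ u])
    then show ?thesis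
      using metric_compatible[OF \<phi>(1) x smooth_on_const, of u v] by (simp add: cov_deriv_def)
  qed
  obtain e where e: "\<forall>i\<in>{1..n}. e i \<in> V"
      "\<forall>i\<in>{1..n}. \<forall>j\<in>{1..n}. g \<phi> x (e i) (e j) = (if i = j then 1 else 0)"
    using orthonormal_frame_exists[OF g_bilinear[OF \<phi>(1) x] g_sym[OF \<phi>(1) x] V(1) pos, of n] V(2) by auto
  show ?thesis
  proof (intro bexI[OF _ \<phi>(1)] exI[of _ e] conjI ballI \<phi>(2))
    show "leaf_frame A g F n \<phi> p e"
      using e slice[OF \<phi>(2)] by (auto simp: leaf_frame_def V_def x_def inner_commute)
    show "g \<phi> (coord \<phi> p) (shape \<phi> (coord \<phi> p) (e i)) (e j) =
        g \<phi> (coord \<phi> p) (shape \<phi> (coord \<phi> p) (e j)) (e i)" if "i \<in> {1..n}" "j \<in> {1..n}" for i j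
      using shape_eq e(1) that Gamma_sym[OF \<phi>(1) x, of "e i" "e j"] unfolding x_def[symmetric] by simp
  qed
qed

lemma mean_curvature_eq_expansion:
  assumes \<phi>: "\<phi> \<in> A" and p: "p \<in> dom_of \<phi>"
  shows "mean_curvature A g nabla F N n p = expansion \<phi> (coord \<phi> p) / n"
proof -
  have frame_mean: "- (1 / real n) * (\<Sum>i=1..n. second_form g nabla N \<psi> p e i i) = expansion \<phi> (coord \<phi> p) / n"
    if \<psi>: "\<psi> \<in> A" "p \<in> dom_of \<psi>" and e: "leaf_frame A g F n \<psi> p e" for \<psi> e
  proof -
    note frame = leaf_frame_imp_lorentz_frame[OF \<psi> e]
    have "(\<Sum>i=1..n. second_form g nabla N \<psi> p e i i) = - expansion \<psi> (coord \<psi> p)"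
      unfolding expansion_in_frame[OF \<psi>(1) coord_in[OF \<psi>] frame]
      by (simp add: second_form_def cov_deriv_def shape_def sum_negf)
    also have "expansion \<psi> (coord \<psi> p) = expansion \<phi> (coord \<phi> p)"
      using expansion_invariant[OF \<psi>(1) \<phi> _ frame] \<psi>(2) p by simp
    finally show ?thesis by simp
  qed
  obtain \<psi> e where \<psi>: "\<psi> \<in> A" "p \<in> dom_of \<psi>" "leaf_frame A g F n \<psi> p e"
    using adapted_frame[of p] by blast
  show ?thesis
    unfolding mean_curvature_def
  proof (rule the_equality)
    show "\<exists>\<psi>\<in>A. \<exists>e. p \<in> dom_of \<psi> \<and> leaf_frame A g F n \<psi> p e \<and>
        expansion \<phi> (coord \<phi> p) / n = - (1 / real n) * (\<Sum>i=1..n. second_form g nabla N \<psi> p e i i)"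
      using \<psi> frame_mean[OF \<psi>, symmetric] by (intro bexI[OF _ \<psi>(1)] exI[of _ e] conjI)
  next
    fix H
    assume "\<exists>\<psi>\<in>A. \<exists>e. p \<in> dom_of \<psi> \<and> leaf_frame A g F n \<psi> p e \<and>
        H = - (1 / real n) * (\<Sum>i=1..n. second_form g nabla N \<psi> p e i i)"
    then obtain \<psi> e where \<psi>: "\<psi> \<in> A" "p \<in> dom_of \<psi>" "leaf_frame A g F n \<psi> p e"
      and "H = - (1 / real n) * (\<Sum>i=1..n. second_form g nabla N \<psi> p e i i)"
      by (elim bexE exE conjE)
    then show "H = expansion \<phi> (coord \<phi> p) / n" using frame_mean[OF \<psi>] by (simp only:)
  qed
qed

text \<open>Raychaudhuri's equation in a frame adapted to the foliation. The derivative of the mean curvature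
along \<open>\<gamma>\<close> is that of the expansion in the direction \<open>N\<close>, divided by \<open>n\<close>.\<close>

lemma mean_curvature_riccati:
  assumes \<gamma>: "smooth_curve A \<gamma>"
    and tangent: "\<And>\<phi>. \<phi> \<in> A \<Longrightarrow> \<gamma> t \<in> dom_of \<phi> \<Longrightarrow> velocity \<phi> \<gamma> t = N \<phi> (coord \<phi> (\<gamma> t))"
  shows "\<exists>d. ((\<lambda>t. mean_curvature A g nabla F N n (\<gamma> t)) has_real_derivative d) (at t) \<and>
    d \<le> c - (mean_curvature A g nabla F N n (\<gamma> t))\<^sup>2"
proof -
  obtain \<phi> e where \<phi>: "\<phi> \<in> A" "\<gamma> t \<in> dom_of \<phi>" and e: "leaf_frame A g F n \<phi> (\<gamma> t) e"
    and self_adjoint: "\<And>i j. i \<in> {1..n} \<Longrightarrow> j \<in> {1..n} \<Longrightarrow>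
      g \<phi> (coord \<phi> (\<gamma> t)) (shape \<phi> (coord \<phi> (\<gamma> t)) (e i)) (e j) =
      g \<phi> (coord \<phi> (\<gamma> t)) (shape \<phi> (coord \<phi> (\<gamma> t)) (e j)) (e i)"
    using adapted_frame[of "\<gamma> t"] by blast
  define x where "x = coord \<phi> (\<gamma> t)"
  note x = coord_in[OF \<phi>, folded x_def]
  interpret lorentz_frame "g \<phi> x" n e "N \<phi> x"
    using leaf_frame_imp_lorentz_frame[OF \<phi> e] by (simp add: x_def)
  let ?R = "\<lambda>b. curvature nabla \<phi> (\<lambda>_. b) (\<lambda>_. N \<phi> x) (\<lambda>_. N \<phi> x) x"
  obtain E where E: "(expansion \<phi> has_derivative E) (at x)"
    "E (N \<phi> x) = - endo_trace ?R - endo_trace (\<lambda>b. shape \<phi> x (shape \<phi> x b))"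
    using raychaudhuri[OF \<phi>(1) x] by blast
  note R = curvature_const_fields[where \<Gamma> = nabla and \<phi> = \<phi> and x = x, OF Gamma_bilinear[OF \<phi>(1) x]]
  \<comment> \<open>Linearity of the curvature in its first argument is needed to compute its trace in the frame.\<close>
  have "linear ?R"
  proof -
    have "linear (\<lambda>v. nabla \<phi> y v u)" if "y \<in> img_of \<phi>" for y u
      using Gamma_bilinear[OF \<phi>(1) that] by (simp add: bilinear_def)
    note lin = this
    have "linear (nabla \<phi> x u)" for u using Gamma_bilinear[OF \<phi>(1) x] by (simp add: bilinear_def)
    from linear_compose[OF lin[OF x] this] have "linear (\<lambda>b. nabla \<phi> x u (nabla \<phi> x b w))" for u w
      by (simp add: o_def)
    then show ?thesis
      unfolding R
      by (intro linear_compose_add linear_compose_sub lin[OF x] has_derivative_linear[OF Gamma_has_derivative[OF \<phi>(1) x]]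
          linear_field_derivative_linear[OF open_img[OF \<phi>(1)] x lin Gamma_has_derivative[OF \<phi>(1) x]])
  qed
  then have "endo_trace ?R = (\<Sum>i=1..n. g \<phi> x (?R (e i)) (e i)) - g \<phi> x (?R (N \<phi> x)) (N \<phi> x)"
    by (rule trace_eq)
  also have "?R (N \<phi> x) = 0" unfolding R by simp
  also have "(\<Sum>i=1..n. g \<phi> x (?R (e i)) (e i)) = (\<Sum>i=1..n. - c)"
  proof (rule sum.cong)
    fix i assume i: "i \<in> {1..n}"
    have g: "g \<phi> x (e i) (e i) = 1" "g \<phi> x (N \<phi> x) (N \<phi> x) = - 1" "g \<phi> x (e i) (N \<phi> x) = 0"
      using ortho[OF i i] unit normal[OF i] sym[of "e i" "N \<phi> x"] by simp_all
    then have "sectional_curvature g nabla \<phi> x (e i) (N \<phi> x) = c"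
      using const_curv \<phi>(1) x unfolding constant_sectional_curvature_def by simp
    then show "g \<phi> x (?R (e i)) (e i) = - c"
      by (simp add: sectional_curvature_def g)
  qed simp
  finally have tr_R: "endo_trace ?R = - (n * c)"
    using bilinear_lzero[OF bilin] by simp
  have "(expansion \<phi> x)\<^sup>2 \<le> n * endo_trace (\<lambda>b. shape \<phi> x (shape \<phi> x b))"
    unfolding expansion_def
    using trace_square_ge[OF shape_linear[OF \<phi>(1) x] shape_N[OF \<phi>(1) x] shape_orthogonal[OF \<phi>(1) x]]
      self_adjoint unfolding x_def by blast
  then have tr_S: "(expansion \<phi> x / n)\<^sup>2 \<le> endo_trace (\<lambda>b. shape \<phi> x (shape \<phi> x b)) / n"
    using n_pos by (simp add: power_divide field_simps power2_eq_square)
  have "((\<lambda>s. coord \<phi> (\<gamma> s)) has_derivative (\<lambda>h. h *\<^sub>R N \<phi> x)) (at t)"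
    using smooth_curve_has_velocity[OF \<phi>(1) \<gamma> \<phi>(2)] tangent[OF \<phi>]
    by (simp add: has_vector_derivative_def x_def)
  from has_derivative_compose[OF this E(1)[unfolded x_def]]
  have "((\<lambda>s. expansion \<phi> (coord \<phi> (\<gamma> s))) has_real_derivative E (N \<phi> x)) (at t)"
    by (simp add: has_field_derivative_def linear_scale[OF has_derivative_linear[OF E(1)]]
        mult.commute[of _ "E (N \<phi> x)"])
  then have "((\<lambda>s. expansion \<phi> (coord \<phi> (\<gamma> s)) / n) has_real_derivative E (N \<phi> x) / n) (at t)"
    by (rule DERIV_cdivide)
  then have "((\<lambda>s. mean_curvature A g nabla F N n (\<gamma> s)) has_real_derivative E (N \<phi> x) / n) (at t)"
    by (rule has_field_derivative_transform_within_open[OF _ smooth_curve_open_preimage[OF chart[OF \<phi>(1)] \<gamma>]])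
      (use \<phi> mean_curvature_eq_expansion[OF \<phi>(1)] in auto)
  moreover have "E (N \<phi> x) / n \<le> c - (mean_curvature A g nabla F N n (\<gamma> t))\<^sup>2"
    using tr_S n_pos unfolding E(2) tr_R mean_curvature_eq_expansion[OF \<phi>] x_def[symmetric]
    by (simp add: diff_divide_distrib)
  ultimately show ?thesis by blast
qed

lemma mean_curvature_bound:
  assumes complete: "geodesically_complete A nabla"
  shows "(mean_curvature A g nabla F N n p)\<^sup>2 \<le> c"
proof -
  obtain \<phi> where \<phi>: "\<phi> \<in> A" "p \<in> dom_of \<phi>" using chart_exists by blast
  obtain \<gamma> where \<gamma>: "geodesic A nabla \<gamma>" "\<gamma> 0 = p" "velocity \<phi> \<gamma> 0 = N \<phi> (coord \<phi> p)"
    using complete \<phi> unfolding geodesically_complete_def by blast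
  let ?h = "\<lambda>t. mean_curvature A g nabla F N n (\<gamma> t)"
  have "\<exists>d. (?h has_real_derivative d) (at t) \<and> d \<le> c - (?h t)\<^sup>2" for t
  proof (rule mean_curvature_riccati)
    show "smooth_curve A \<gamma>" using \<gamma>(1) unfolding geodesic_def by blast
    show "velocity \<psi> \<gamma> t = N \<psi> (coord \<psi> (\<gamma> t))" if "\<psi> \<in> A" "\<gamma> t \<in> dom_of \<psi>" for \<psi>
      by (rule geodesic_is_integral_curve[OF \<gamma>(1) \<phi>(1) _ _ that]) (simp_all add: \<gamma>(2,3) \<phi>(2))
  qed
  then obtain h' where "\<And>t. (?h has_real_derivative h' t) (at t)" "\<And>t. h' t \<le> c - (?h t)\<^sup>2"
    by metis
  from riccati_global_bound[OF this, of 0] show ?thesis using \<gamma>(2) by simp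
qed

end

theorem corollary4p3:
  fixes A :: "('m::{t2_space, second_countable_topology}, 'e::euclidean_space) chart set"
    and g :: "('m, 'e) metric"
    and nabla :: "('m, 'e) connection"
    and F :: "'m set set"
    and N :: "('m, 'e) vfield"
    and n :: nat and c :: real
  assumes "n \<ge> 1" and "DIM('e) = n + 1"
    and "smooth_structure A"
    and "lorentz_metric A g"
    and "levi_civita A g nabla"
    and "geodesically_complete A nabla"
    and "constant_sectional_curvature A g nabla c"
    and "spacelike_foliation A g F"
    and "vector_field A N"
    and "unit_timelike A g N"
    and "normal_to_leaves A g F N"
    and "geodesic_flow A nabla N"
  shows "c \<ge> 0 \<and> (\<forall>p. (mean_curvature A g nabla F N n p)\<^sup>2 \<le> c)"
proof -
  interpret lorentz_geodesic_foliation A g nabla N F n c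
    by unfold_locales (fact assms)+
  have bound: "(mean_curvature A g nabla F N n p)\<^sup>2 \<le> c" for p
    by (rule mean_curvature_bound) (rule assms)
  have "0 \<le> c" by (rule order_trans[OF zero_le_power2 bound])
  then show ?thesis using bound by blast
qed

end
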